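(* Let $F(x) = x^n+ ax+b \in \mathbb{Z}[x]$ be irreducible over $\mathbb{Q}$ and let $K=\mathbb{Q}(\theta)$, where $\theta$ is a complex root of $F(x)$. Let $p$ be an odd prime number such that $p \mid a$, $p \mid n$ and $p \nmid b$. Write $n = s\cdot p^r$, where $p \nmid s$. Let $\mu = \nu_p(a)$, $\nu =\nu_p(b^{p-1}-1)$, $\delta = \min (\mu, \nu)$, and $\omega = \min(\delta,r+1)$. If one of the following conditions holds: (1) $\delta \neq r+1$ and $\omega > \frac{N_p(m)}{N_p(m,s,b)}$ for some integer $m > 1$ (with $N_p(m,s,b)>0$); (2) $\frac{p}{N_p(1,s,b)}<\mu< \min(\nu,r+1)$ (with $N_p(1,s,b)>0$); (3) $\frac{p}{N_p(1,s,b)}<\nu <\min(\mu,r+1)$ (with $N_p(1,s,b)>0$); (4) $\frac{p}{N_p(1,s,b)}<r+1 < \delta$ (with $N_p(1,s,b)>0$); then $K$ is not monogenic.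
   Context: For a prime $p$ and an integer $t$, $\nu_p(t)$ is the $p$-adic valuation of $t$ (with $\nu_p(0)=\infty$). $\mathbb{F}_p$ is the field with $p$ elements. For positive integers $m,s$ and an integer $t$: $N_p(m)$ denotes the number of monic irreducible polynomials of degree $m$ in $\mathbb{F}_p[x]$, and $N_p(m,s,t)$ denotes the number of monic irreducible factors of degree $m$ of the polynomial $x^s+\overline{t}$ in $\mathbb{F}_p[x]$, where $\overline{t}$ is the reduction of $t$ modulo $p$. $\mathbb{Z}_K$ denotes the ring of integers of $K$. $K$ is called monogenic if $\mathbb{Z}_K=\mathbb{Z}[\eta]$ for some $\eta\in\mathbb{Z}_K$ with $K=\mathbb{Q}(\eta)$; otherwise $K$ is not monogenic. *)

theory Defs
  imports
    "HOL-Library.Extended_Nat"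
    "HOL-Library.Extended_Real"
    "HOL-Computational_Algebra.Computational_Algebra"
    "Berlekamp_Zassenhaus.Finite_Field"
begin

definition padic_val :: "nat \<Rightarrow> int \<Rightarrow> enat" where
  "padic_val p t = (if t = 0 then \<infinity> else enat (multiplicity (int p) t))"

(* The field with p elements is 'p mod_ring, where the class prime_card says that
   CARD('p) = p is prime. *)

definition num_monic_irred :: "'p::prime_card itself \<Rightarrow> nat \<Rightarrow> nat" where
  "num_monic_irred _ m =
     card {f :: 'p mod_ring poly. monic f \<and> Factorial_Ring.irreducible f \<and> Polynomial.degree f = m}"

(* Factors are counted without multiplicity. *)

definition num_monic_irred_factors :: "'p::prime_card itself \<Rightarrow> nat \<Rightarrow> nat \<Rightarrow> int \<Rightarrow> nat" where
  "num_monic_irred_factors _ m s t =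
     card {f :: 'p mod_ring poly. monic f \<and> Factorial_Ring.irreducible f \<and> Polynomial.degree f = m \<and>
             f dvd Polynomial.monom 1 s + [:of_int t:]}"

(* Since inverse 0 = 0 in HOL, closure under inverse needs no side condition. *)

definition subfield_of_complex :: "complex set \<Rightarrow> bool" where
  "subfield_of_complex L \<longleftrightarrow>
     1 \<in> L \<and> (\<forall>x\<in>L. \<forall>y\<in>L. x - y \<in> L \<and> x * y \<in> L) \<and> (\<forall>x\<in>L. inverse x \<in> L)"

definition rat_adjoin :: "complex \<Rightarrow> complex set" where
  "rat_adjoin \<theta> = \<Inter> {L. subfield_of_complex L \<and> \<theta> \<in> L}"

definition int_adjoin :: "complex \<Rightarrow> complex set" where
  "int_adjoin \<eta> = range (\<lambda>g :: int poly. poly (map_poly of_int g) \<eta>)"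

definition ring_of_integers :: "complex set \<Rightarrow> complex set" where
  "ring_of_integers K = {x \<in> K. algebraic_int x}"

definition monogenic :: "complex set \<Rightarrow> bool" where
  "monogenic K \<longleftrightarrow>
     (\<exists>\<eta> \<in> ring_of_integers K. ring_of_integers K = int_adjoin \<eta> \<and> K = rat_adjoin \<eta>)"

end

theory Submission
  imports Defs "HOL-Computational_Algebra.Field_as_Ring"
begin

hide_const (open) up_ring.coeff up_ring.monom module.smult

text \<open>If the ring of integers is \<open>\<int>[\<eta>]\<close>, its primes of residue degree \<open>m\<close> above \<open>p\<close> correspond to
  irreducible factors of degree \<open>m\<close> of the minimal polynomial of \<open>\<eta>\<close> modulo \<open>p\<close>, so there are at most
  \<open>N_p(m)\<close> of them. Modulo \<open>p\<close> the trinomial is \<open>(x^s + b)^(p^r)\<close>. For every irreducible factor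
  \<open>\<phi>\<close> of \<open>x^s + b\<close> of degree \<open>m\<close> the \<open>\<phi>\<close>-Newton polygon has \<open>\<omega>\<close> sides, all of height or length
  one, and each of them yields a prime whose residue field is \<open>F_p[x]/(\<phi>)\<close>. Hence \<open>\<omega> N_p(m,s,b) \<le> N_p(m)\<close>, which
  each of the four conditions contradicts.

  Primes are realised by a valuation ring \<open>V\<close> of the complex numbers in which \<open>p\<close> is not a unit: the
  sides of the polygon give conjugates \<open>x\<close> of \<open>\<theta>\<close>, and the prime is the preimage of the maximal ideal
  of \<open>V\<close> under the embedding \<open>\<theta> \<mapsto> x\<close>. The primes of different sides are separated by Ore's
  quotients, which are integral.\<close>

section \<open>Valuation rings\<close>

text \<open>Valuation rings of an algebraically closed field replace both ideal factorisation and
  completions: roots of every slope already exist, and integrality is membership in all valuation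
  rings. Irreducibility of \<open>F\<close> carries every identity between rational polynomials in
  \<theta> over to any other root \<open>x\<close>. When \<eta> generates the ring of integers,
  \<theta> and the quotients \<open>z k\<close> are integer polynomials in \<eta>. The residue of
  the conjugate of \<eta> therefore determines both \<phi> (through \<theta>) and the side (through
  the \<open>z k\<close>), and the minimal polynomial of this residue over \<open>F_p\<close> labels
  the pairs injectively. The delicate point is that this polynomial has degree exactly
  \<open>m\<close>: the residue field at a root must not outgrow \<open>F_p[x]/(\<phi>)\<close>,
  which is shown with an explicit uniformizer. The count \<omega> arises because the binomial
  coefficients put vertices at (\<open>p ^ k\<close>, \<open>r - k\<close>), and a start at height
  \<omega> on the vertical axis removes those of height at least \<omega>, leaving the indices from
  \<kappa> = r + 1 - \<omega> to \<open>r\<close>. For p = 2 the first two sides could have equal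
  slope and merge.\<close>

definition subring_of :: "'a::field set \<Rightarrow> bool" where
  "subring_of S \<longleftrightarrow> 1 \<in> S \<and> (\<forall>x\<in>S. \<forall>y\<in>S. x - y \<in> S \<and> x * y \<in> S)"

lemma subring_ofD:
  assumes "subring_of S"
  shows "1 \<in> S" "0 \<in> S" "x \<in> S \<Longrightarrow> y \<in> S \<Longrightarrow> x - y \<in> S" "x \<in> S \<Longrightarrow> y \<in> S \<Longrightarrow> x * y \<in> S"
    "x \<in> S \<Longrightarrow> - x \<in> S" "x \<in> S \<Longrightarrow> y \<in> S \<Longrightarrow> x + y \<in> S" "x \<in> S \<Longrightarrow> x ^ n \<in> S"
proof -
  show 1: "1 \<in> S" using assms by (auto simp: subring_of_def)
  show d: "x \<in> S \<Longrightarrow> y \<in> S \<Longrightarrow> x - y \<in> S" for x y using assms by (auto simp: subring_of_def)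
  show m: "x \<in> S \<Longrightarrow> y \<in> S \<Longrightarrow> x * y \<in> S" for x y using assms by (auto simp: subring_of_def)
  show 0: "0 \<in> S" using d[OF 1 1] by simp
  show u: "x \<in> S \<Longrightarrow> - x \<in> S" for x using d[OF 0, of x] by simp
  show "x \<in> S \<Longrightarrow> y \<in> S \<Longrightarrow> x + y \<in> S" using d[of x "-y"] u[of y] by simp
  show "x \<in> S \<Longrightarrow> x ^ n \<in> S" by (induction n) (auto intro: 1 m)
qed

lemma subring_of_sum:
  assumes "subring_of S" "\<And>i. i \<in> I \<Longrightarrow> f i \<in> S"
  shows "sum f I \<in> S"
  using assms(2) by (induction I rule: infinite_finite_induct) (auto intro: subring_ofD[OF assms(1)])

lemma subring_of_of_nat: "subring_of S \<Longrightarrow> of_nat n \<in> S"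
  by (induction n) (auto intro: subring_ofD)

lemma subring_of_of_int: "subring_of S \<Longrightarrow> of_int i \<in> S"
  by (cases i) (auto intro: subring_ofD subring_of_of_nat simp del: of_nat_Suc)

definition adjoin :: "'a::field set \<Rightarrow> 'a \<Rightarrow> 'a set" where
  "adjoin S x = {poly P x | P. \<forall>i. coeff P i \<in> S}"

lemma subring_of_adjoin:
  assumes "subring_of S"
  shows "subring_of (adjoin S x)"
proof -
  note S = subring_ofD[OF assms]
  have "\<exists>P. 1 = poly P x \<and> (\<forall>i. coeff P i \<in> S)"
    by (rule exI[of _ 1]) (auto simp: coeff_1 intro: S)
  moreover have "\<exists>R. poly P x - poly Q x = poly R x \<and> (\<forall>i. coeff R i \<in> S)"
    if "\<forall>i. coeff P i \<in> S" "\<forall>i. coeff Q i \<in> S" for P Q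
    by (rule exI[of _ "P - Q"]) (use that in \<open>auto intro: S\<close>)
  moreover have "\<exists>R. poly P x * poly Q x = poly R x \<and> (\<forall>i. coeff R i \<in> S)"
    if "\<forall>i. coeff P i \<in> S" "\<forall>i. coeff Q i \<in> S" for P Q
    by (rule exI[of _ "P * Q"]) (use that in \<open>auto intro!: S subring_of_sum[OF assms] simp: coeff_mult\<close>)
  ultimately show ?thesis by (fastforce simp: subring_of_def adjoin_def)
qed

lemma adjoin_superset:
  assumes "subring_of S"
  shows "S \<subseteq> adjoin S x" "x \<in> adjoin S x"
proof -
  show "S \<subseteq> adjoin S x"
  proof
    fix y assume "y \<in> S"
    then have "\<forall>i. coeff [:y:] i \<in> S"
      by (auto simp: coeff_pCons intro: subring_ofD(2)[OF assms] split: nat.splits)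
    then show "y \<in> adjoin S x" unfolding adjoin_def by (intro CollectI exI[of _ "[:y:]"]) simp
  qed
  have "\<forall>i. coeff [:0, 1:] i \<in> S"
    by (auto simp: coeff_pCons intro: subring_ofD[OF assms] split: nat.splits)
  then show "x \<in> adjoin S x" unfolding adjoin_def by (intro CollectI exI[of _ "[:0, 1:]"]) simp
qed

text \<open>Zero is named separately because \<open>inverse 0 = 0\<close> would make it look
  invertible. For a valuation ring this set is the maximal ideal.\<close>

definition nonunits :: "'a::field set \<Rightarrow> 'a set" where
  "nonunits V = {x \<in> V. x = 0 \<or> inverse x \<notin> V}"

locale valuation_ring =
  fixes V :: "'a::field set"
  assumes subring: "subring_of V"
    and total: "x \<in> V \<or> inverse x \<in> V"
begin

lemmas V_closed [intro, simp] =
  subring_ofD[OF subring] subring_of_sum[OF subring] subring_of_of_nat[OF subring]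
  subring_of_of_int[OF subring]

abbreviation \<mm> :: "'a set" where "\<mm> \<equiv> nonunits V"

lemma nonunits_subset: "x \<in> \<mm> \<Longrightarrow> x \<in> V"
  by (simp add: nonunits_def)

lemma zero_nonunit [simp]: "0 \<in> \<mm>"
  by (simp add: nonunits_def)

lemma one_not_nonunit [simp]: "1 \<notin> \<mm>"
  by (simp add: nonunits_def)

lemma inverse_nonunit: "x \<notin> V \<Longrightarrow> inverse x \<in> \<mm>"
  using total[of x] by (auto simp: nonunits_def)

lemma inverse_mem: "x \<in> V \<Longrightarrow> x \<notin> \<mm> \<Longrightarrow> inverse x \<in> V"
  by (simp add: nonunits_def)

lemma nonunit_mult: 
  assumes "x \<in> \<mm>" "y \<in> V"
  shows "x * y \<in> \<mm>" "y * x \<in> \<mm>"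
proof -
  have "inverse (x * y) \<notin> V" if "x \<noteq> 0" "y \<noteq> 0"
  proof
    assume "inverse (x * y) \<in> V"
    then have "inverse (x * y) * y \<in> V" using assms by (intro V_closed)
    moreover have "inverse (x * y) * y = inverse x" using that by (simp add: field_simps)
    ultimately have "inverse x \<in> V" by metis
    then show False using assms that by (simp add: nonunits_def)
  qed
  then show "x * y \<in> \<mm>" using assms by (auto simp: nonunits_def)
  then show "y * x \<in> \<mm>" by (simp add: mult.commute)
qed

lemma nonunit_uminus: "x \<in> \<mm> \<Longrightarrow> - x \<in> \<mm>"
  using nonunit_mult(1)[of x "-1"] V_closed(5)[OF V_closed(1)] by simp

text \<open>One of the quotients \<open>x / y\<close> and \<open>y / x\<close> lies in
  \<open>V\<close>, so the sum is one of the two nonunits times an element of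
  \<open>V\<close>.\<close>

lemma nonunit_add: 
  assumes "x \<in> \<mm>" "y \<in> \<mm>"
  shows "x + y \<in> \<mm>"
proof -
  have *: "u + v \<in> \<mm>" if "u \<in> \<mm>" "v \<in> \<mm>" "u / v \<in> V" "v \<noteq> 0" for u v
  proof -
    have "v * (u / v + 1) \<in> \<mm>" using that by (intro nonunit_mult) auto
    moreover have "v * (u / v + 1) = u + v" using that by (simp add: field_simps)
    ultimately show ?thesis by simp
  qed
  show ?thesis
  proof (cases "x = 0 \<or> y = 0")
    case False
    then show ?thesis using *[of x y] *[of y x] assms total[of "x / y"] by (auto simp: add.commute)
  qed (use assms in auto)
qed

lemma nonunit_diff: "x \<in> \<mm> \<Longrightarrow> y \<in> \<mm> \<Longrightarrow> x - y \<in> \<mm>"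
  using nonunit_add[of x "-y"] nonunit_uminus[of y] by simp

lemma nonunit_sum: "(\<And>i. i \<in> I \<Longrightarrow> f i \<in> \<mm>) \<Longrightarrow> sum f I \<in> \<mm>"
  by (induction I rule: infinite_finite_induct) (auto intro: nonunit_add)

lemma nonunit_prime: 
  assumes "x * y \<in> \<mm>"
  shows "x \<in> \<mm> \<or> y \<in> \<mm>"
proof (rule ccontr)
  assume "\<not> ?thesis"
  then have n: "x \<notin> \<mm>" "y \<notin> \<mm>" and nz: "x \<noteq> 0" "y \<noteq> 0" by auto
  then have "inverse x \<in> V" using total[of x] inverse_mem by blast
  then have "inverse x * (x * y) \<in> \<mm>" using assms by (rule nonunit_mult(2)[rotated])
  then show False using n nz by (simp add: field_simps)
qed

lemma nonunit_power: "x \<in> \<mm> \<Longrightarrow> n > 0 \<Longrightarrow> x ^ n \<in> \<mm>"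
  by (cases n) (auto intro: nonunit_mult nonunits_subset)

lemma nonunit_powerD: "x ^ n \<in> \<mm> \<Longrightarrow> x \<in> \<mm>"
  by (induction n) (auto dest: nonunit_prime)

lemma unit_cong: "x - y \<in> \<mm> \<Longrightarrow> x \<in> \<mm> \<longleftrightarrow> y \<in> \<mm>"
  using nonunit_add[of "x - y" y] nonunit_diff[of x "x - y"] by auto

lemma unit_diff:
  assumes "x \<in> V - \<mm>" "y \<in> \<mm>"
  shows "x - y \<in> V - \<mm>"
  using assms nonunit_add[of "x - y" y] nonunits_subset by auto

end

text \<open>If \<open>t = 1 - u * v\<close> had no inverse in \<open>V\<close>, adjoining that
  inverse would by maximality produce \<open>inverse u\<close> as a polynomial in
  \<open>inverse t\<close>. Multiplying by a power of \<open>t\<close>, which is congruent to 1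
  modulo \<open>u\<close>, brings \<open>inverse u\<close> back into \<open>V\<close>.\<close>

lemma maximal_subring_unit:
  assumes V: "subring_of V" and u: "u \<in> V" "u \<noteq> 0" "inverse u \<notin> V"
    and max: "\<And>S. subring_of S \<Longrightarrow> V \<subseteq> S \<Longrightarrow> inverse u \<notin> S \<Longrightarrow> S = V"
    and v: "v \<in> V"
  shows "inverse (1 - u * v) \<in> V" "1 - u * v \<noteq> 0"
proof -
  note VD = subring_ofD[OF V] subring_of_sum[OF V]
  define t where "t = 1 - u * v"
  show nz: "1 - u * v \<noteq> 0"
  proof
    assume "1 - u * v = 0"
    then have "inverse u = v" using u by (simp add: field_simps)
    with u v show False by simp
  qed
  have tV: "t \<in> V" using u v by (auto simp: t_def intro: VD)
  show "inverse (1 - u * v) \<in> V"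
  proof (rule ccontr)
    assume "inverse (1 - u * v) \<notin> V"
    then have "adjoin V (inverse t) \<noteq> V"
      using adjoin_superset[OF V, of "inverse t"] by (auto simp: t_def)
    then have "inverse u \<in> adjoin V (inverse t)"
      using max subring_of_adjoin[OF V] adjoin_superset[OF V] by blast
    then obtain P where P: "\<forall>i. coeff P i \<in> V" "inverse u = poly P (inverse t)"
      by (auto simp: adjoin_def)
    define d where "d = degree P"
    have "t ^ d * poly P (inverse t) = (\<Sum>i\<le>d. coeff P i * t ^ (d - i))"
      unfolding poly_altdef d_def[symmetric] sum_distrib_left
      by (intro sum.cong refl) (use nz in \<open>auto simp: t_def[symmetric] power_diff field_simps\<close>)
    also have "\<dots> \<in> V" using P tV by (auto intro!: VD)
    finally have A: "t ^ d * inverse u \<in> V" by (simp add: P)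
    have "\<exists>w\<in>V. t ^ k = 1 - u * w" for k
    proof (induction k)
      case 0
      show ?case by (rule bexI[of _ 0]) (auto intro: VD)
    next
      case (Suc k)
      then obtain w where w: "w \<in> V" "t ^ k = 1 - u * w" by auto
      have "t ^ Suc k = (1 - u * v) * (1 - u * w)" by (simp add: w(2) flip: t_def)
      also have "\<dots> = 1 - u * (w + v - u * v * w)" by (simp add: algebra_simps)
      finally have "t ^ Suc k = 1 - u * (w + v - u * v * w)" .
      then show ?case using w u v by (intro bexI[of _ "w + v - u * v * w"]) (auto intro!: VD)
    qed
    then obtain w where w: "w \<in> V" "t ^ d = 1 - u * w" by blast
    have "inverse u = t ^ d * inverse u + w" using u by (simp add: w field_simps)
    then show False using VD(6)[OF A w(1)] u by simp
  qed
qed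

text \<open>A subring maximal among those that contain \<open>A\<close> and omit
  \<open>inverse u\<close> is a valuation ring. If neither \<open>x\<close> nor
  \<open>inverse x\<close> belonged to it, \<open>inverse u\<close> would be a polynomial in each of
  them, and the degrees of these two polynomials could be lowered forever.\<close>

lemma exists_valuation_ring:
  fixes A :: "'a::field set"
  assumes A: "subring_of A" and u: "u \<in> A" "u \<noteq> 0" "inverse u \<notin> A"
  obtains V where "valuation_ring V" "A \<subseteq> V" "u \<in> nonunits V"
proof -
  define \<C> where "\<C> = {S. subring_of S \<and> A \<subseteq> S \<and> inverse u \<notin> S}"
  have "\<exists>M\<in>\<C>. \<forall>X\<in>\<C>. M \<subseteq> X \<longrightarrow> X = M"
  proof (rule subset_Zorn_nonempty)
    show "\<C> \<noteq> {}" using A u by (auto simp: \<C>_def)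
    fix C assume C: "C \<noteq> {}" "subset.chain \<C> C"
    have "subring_of (\<Union>C)"
      unfolding subring_of_def
    proof (intro conjI ballI)
      show "1 \<in> \<Union>C" using C by (fastforce simp: \<C>_def subset.chain_def subring_of_def)
      fix x y assume "x \<in> \<Union>C" "y \<in> \<Union>C"
      then obtain X Y where XY: "X \<in> C" "Y \<in> C" "x \<in> X" "y \<in> Y" by auto
      then have "X \<subseteq> Y \<or> Y \<subseteq> X" using C by (auto simp: subset.chain_def)
      then obtain Z where "Z \<in> C" "x \<in> Z" "y \<in> Z" using XY by auto
      moreover from this have "subring_of Z" using C by (auto simp: \<C>_def subset.chain_def)
      ultimately show "x - y \<in> \<Union>C" "x * y \<in> \<Union>C" by (auto simp: subring_of_def)
    qed
    then show "\<Union>C \<in> \<C>" using C by (fastforce simp: \<C>_def subset.chain_def)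
  qed
  then obtain V where V: "subring_of V" "A \<subseteq> V" "inverse u \<notin> V"
    and max: "\<And>S. subring_of S \<Longrightarrow> V \<subseteq> S \<Longrightarrow> inverse u \<notin> S \<Longrightarrow> S = V"
    by (force simp: \<C>_def)
  note VD = subring_ofD[OF V(1)] subring_of_sum[OF V(1)]
  have uV: "u \<in> V" using V u by auto
  \<comment> \<open>\<open>pr x d\<close>: the inverse of \<open>u\<close> is a polynomial in \<open>x\<close> over \<open>V\<close> of degree less than \<open>d\<close>.\<close>
  define pr where "pr = (\<lambda>x d. \<exists>f. (\<forall>i. f i \<in> V) \<and> u * (\<Sum>i<d. f i * x ^ i) = 1)"
  have pr_mono: "pr x d'" if "pr x d" "d \<le> d'" for x d d'
  proof -
    from that obtain f where f: "\<forall>i. f i \<in> V" "u * (\<Sum>i<d. f i * x ^ i) = 1" by (auto simp: pr_def)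
    have "(\<Sum>i<d'. (if i < d then f i else 0) * x ^ i) = (\<Sum>i<d. f i * x ^ i)"
      by (rule sum.mono_neutral_cong_right) (use that in auto)
    then show ?thesis unfolding pr_def
      by (intro exI[of _ "\<lambda>i. if i < d then f i else 0"]) (use f in \<open>auto intro: VD\<close>)
  qed
  \<comment> \<open>The relation in \<open>inverse x\<close>, multiplied by \<open>x ^ d\<close>,
    has the unit \<open>1 - u * g 0\<close> as coefficient of \<open>x ^ d\<close>. It thus
    expresses \<open>x ^ d\<close> by lower powers, and this replaces the top term of the relation
    in \<open>x\<close>.\<close>
  have step: "pr x d" if x: "x \<noteq> 0" "pr x (Suc d)" "pr (inverse x) (Suc d)" for x d
  proof -
    from x obtain f g where f: "\<forall>i. f i \<in> V" "u * (\<Sum>i<Suc d. f i * x ^ i) = 1"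
      and g: "\<forall>i. g i \<in> V" "u * (\<Sum>i<Suc d. g i * inverse x ^ i) = 1" by (auto simp: pr_def)
    define t where "t = 1 - u * g 0"
    have t: "inverse t \<in> V" "t \<noteq> 0"
      using maximal_subring_unit[OF V(1) uV u(2) V(3) max, of "g 0"] g by (auto simp: t_def)
    have "t = u * (\<Sum>i<d. g (Suc i) * inverse x ^ Suc i)"
      using g(2) unfolding sum.lessThan_Suc_shift by (simp add: t_def algebra_simps)
    then have "t * x ^ d = u * (\<Sum>i<d. g (Suc i) * (inverse x ^ Suc i * x ^ d))"
      by (simp add: sum_distrib_right mult.assoc)
    also have "(\<Sum>i<d. g (Suc i) * (inverse x ^ Suc i * x ^ d)) = (\<Sum>i<d. g (Suc i) * x ^ (d - Suc i))"
    proof (intro sum.cong refl)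
      fix i assume "i \<in> {..<d}"
      then have "x ^ d = x ^ (d - Suc i) * x ^ Suc i" 
        by (metis lessThan_iff Suc_leI le_add_diff_inverse2 power_add)
      then show "g (Suc i) * (inverse x ^ Suc i * x ^ d) = g (Suc i) * x ^ (d - Suc i)"
        using x by (simp add: field_simps)
    qed
    also have "\<dots> = (\<Sum>i<d. g (d - i) * x ^ i)"
      by (subst sum.nat_diff_reindex[symmetric]) (auto intro!: sum.cong)
    finally have xd: "x ^ d = inverse t * (u * (\<Sum>i<d. g (d - i) * x ^ i))"
      using t by (simp add: field_simps)
    have "u * (\<Sum>i<d. (f i + f d * inverse t * u * g (d - i)) * x ^ i)
        = u * ((\<Sum>i<d. f i * x ^ i) + f d * (inverse t * (u * (\<Sum>i<d. g (d - i) * x ^ i))))"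
      by (simp add: sum.distrib sum_distrib_left algebra_simps)
    also have "\<dots> = 1" using f(2) by (simp flip: xd)
    finally show ?thesis unfolding pr_def
      by (intro exI[of _ "\<lambda>i. f i + f d * inverse t * u * g (d - i)"])
        (use f g t uV in \<open>auto intro!: VD\<close>)
  qed
  \<comment> \<open>A common bound for \<open>x\<close> and \<open>inverse x\<close> makes the step
    applicable to both, so both bounds drop together down to the empty sum.\<close>
  have no_pr: "\<not> (pr x d \<and> pr (inverse x) d)" if "x \<noteq> 0" for x d
  proof (induction d)
    case 0
    show ?case by (simp add: pr_def)
  next
    case (Suc d)
    then show ?case using step[of x d] step[of "inverse x" d] that by auto
  qed
  have ex_pr: "\<exists>d. pr x d" if "x \<notin> V" for x
  proof -
    have "adjoin V x \<noteq> V" using adjoin_superset[OF V(1), of x] that by auto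
    then have "inverse u \<in> adjoin V x"
      using max subring_of_adjoin[OF V(1)] adjoin_superset[OF V(1)] by blast
    then obtain P where P: "\<forall>i. coeff P i \<in> V" "inverse u = poly P x" by (auto simp: adjoin_def)
    have "u * (\<Sum>i<Suc (degree P). coeff P i * x ^ i) = u * inverse u"
      by (simp only: P(2) poly_altdef lessThan_Suc_atMost)
    also have "\<dots> = 1" using u by simp
    finally have "u * (\<Sum>i<Suc (degree P). coeff P i * x ^ i) = 1" .
    then have "pr x (Suc (degree P))" unfolding pr_def
      using P(1) by (intro exI[of _ "coeff P"]) blast
    then show ?thesis ..
  qed
  have "x \<in> V \<or> inverse x \<in> V" for x
  proof (rule ccontr)
    assume n: "\<not> (x \<in> V \<or> inverse x \<in> V)"
    then obtain d e where "pr x d" "pr (inverse x) e" using ex_pr by blast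
    then have "pr x (max d e)" "pr (inverse x) (max d e)" by (auto intro: pr_mono)
    moreover have "x \<noteq> 0" using n by (auto intro: VD)
    ultimately show False using no_pr by blast
  qed
  then have "valuation_ring V" using V by unfold_locales
  moreover have "u \<in> nonunits V" using uV V u by (auto simp: nonunits_def)
  ultimately show ?thesis using V that by blast
qed

section \<open>Integral elements and valuation rings\<close>

context valuation_ring
begin

text \<open>Valuation rings are integrally closed: if \<open>x\<close> were outside
  \<open>V\<close>, dividing the equation by the top power of \<open>x\<close> would write 1 as a
  sum of nonunits.\<close>

lemma monic_root_mem:
  assumes "lead_coeff P = 1" "\<And>i. coeff P i \<in> V" "poly P x = 0"
  shows "x \<in> V"
proof (rule ccontr)
  assume x: "x \<notin> V"
  then have ix: "inverse x \<in> \<mm>" by (rule inverse_nonunit)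
  have x0: "x \<noteq> 0" using x by auto
  define d where "d = degree P"
  have "0 = poly P x * inverse x ^ d" using assms by simp
  also have "\<dots> = (\<Sum>i\<le>d. coeff P i * inverse x ^ (d - i))"
    unfolding poly_altdef d_def[symmetric] sum_distrib_right
    by (intro sum.cong refl) (use x0 in \<open>auto simp: power_diff field_simps\<close>)
  also have "\<dots> = 1 + (\<Sum>i<d. coeff P i * inverse x ^ (d - i))"
    using assms(1) by (simp add: lessThan_Suc_atMost[symmetric] d_def)
  finally have "1 = - (\<Sum>i<d. coeff P i * inverse x ^ (d - i))" by (simp add: add_eq_0_iff)
  also have "\<dots> \<in> \<mm>"
    by (intro nonunit_uminus nonunit_sum nonunit_mult nonunit_power ix assms) auto
  finally show False by simp
qed

lemma quadratic_root_mem: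
  assumes "\<alpha> \<in> V" "\<beta> \<in> V" "x * (x - \<alpha>) = \<beta>"
  shows "x \<in> V"
proof (rule monic_root_mem[of "[:-\<beta>, -\<alpha>, 1:]"])
  show "coeff [:- \<beta>, - \<alpha>, 1:] i \<in> V" for i
    using assms by (auto simp: coeff_pCons split: nat.splits)
qed (use assms in \<open>auto simp: algebra_simps\<close>)

end

lemma valuation_ring_algebraic_int:
  fixes V :: "'a::field_char_0 set"
  assumes "valuation_ring V" "algebraic_int x"
  shows "x \<in> V"
proof -
  interpret valuation_ring V by fact
  from assms(2) obtain P where P: "lead_coeff P = 1" "\<forall>i. coeff P i \<in> \<int>" "poly P x = 0"
    by (auto elim: algebraic_int.cases)
  have "coeff P i \<in> V" for i
  proof -
    obtain k where "coeff P i = of_int k" using P(2) by (meson Ints_cases)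
    then show ?thesis by simp
  qed
  then show ?thesis by (rule monic_root_mem[OF P(1) _ P(3)])
qed

text \<open>If \<open>x\<close> is not integral, it is not a polynomial in \<open>inverse x\<close>,
  so \<open>inverse x\<close> is a nonunit of \<open>\<int>[inverse x]\<close> and stays one in some
  valuation ring, which then omits \<open>x\<close>. The criterion allows integrality of Ore's
  quotients to be checked in one valuation ring at a time.\<close>

lemma algebraic_int_iff_valuation_rings:
  fixes x :: "'a::field_char_0"
  shows "algebraic_int x \<longleftrightarrow> (\<forall>V. valuation_ring V \<longrightarrow> x \<in> V)"
proof
  assume *: "\<forall>V. valuation_ring V \<longrightarrow> x \<in> V"
  show "algebraic_int x"
  proof (rule ccontr)
    assume n: "\<not> algebraic_int x"
    then have x0: "x \<noteq> 0" by auto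
    have Z: "subring_of (\<int> :: 'a set)" by (auto simp: subring_of_def)
    define A where "A = adjoin \<int> (inverse x)"
    have "x \<notin> A"
    proof
      assume "x \<in> A"
      then obtain P where P: "\<forall>i. coeff P i \<in> \<int>" "x = poly P (inverse x)" by (auto simp: A_def adjoin_def)
      define d where "d = degree P"
      \<comment> \<open>The monic equation of \<open>x\<close> obtained by multiplying
        \<open>x = poly P (inverse x)\<close> by \<open>x ^ d\<close>.\<close>
      define Q where "Q = monom 1 (Suc d) - (\<Sum>i\<le>d. monom (coeff P i) (d - i))"
      have S: "degree (\<Sum>i\<le>d. monom (coeff P i) (d - i)) \<le> d"
        by (intro degree_sum_le) (auto intro: order.trans[OF degree_monom_le])
      have cQ: "coeff Q (Suc d) = 1"
        using S by (simp add: Q_def coeff_eq_0)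
      moreover have "degree Q \<le> Suc d" unfolding Q_def
        by (intro degree_diff_le) (use S in \<open>auto simp: degree_monom_le\<close>)
      ultimately have "degree Q = Suc d" by (intro antisym le_degree) auto
      with cQ have "lead_coeff Q = 1" by simp
      moreover have "\<forall>i. coeff Q i \<in> \<int>" using P(1)
        by (auto simp: Q_def coeff_sum intro!: Ints_diff Ints_sum)
      moreover have "poly Q x = 0"
      proof -
        have "x ^ d * x = x ^ d * poly P (inverse x)" using P(2) by simp
        also have "\<dots> = (\<Sum>i\<le>d. coeff P i * x ^ (d - i))"
          unfolding poly_altdef d_def[symmetric] sum_distrib_left
          by (intro sum.cong refl) (use x0 in \<open>auto simp: power_diff field_simps\<close>)
        finally show ?thesis by (simp add: Q_def poly_monom poly_sum mult.commute)
      qed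
      ultimately show False using n by (blast intro: algebraic_int.intros)
    qed
    then obtain V where "valuation_ring V" "inverse x \<in> nonunits V"
      using exists_valuation_ring[of A "inverse x"] x0 subring_of_adjoin[OF Z] adjoin_superset[OF Z]
      unfolding A_def by (metis inverse_inverse_eq inverse_nonzero_iff_nonzero)
    moreover from this have "x \<notin> V" using x0 by (auto simp: nonunits_def)
    ultimately show False using * by blast
  qed
qed (use valuation_ring_algebraic_int in blast)

section \<open>Roots of polynomials over valuation rings\<close>

context valuation_ring
begin

text \<open>The value is the product of the differences of \<open>x\<close> to the roots, and the
  maximal ideal is prime. This turns an approximate root into an exact root with the same
  residue.\<close>

lemma monic_value_nonunit:
  fixes P :: "'a poly"
  assumes "\<And>P :: 'a poly. degree P > 0 \<Longrightarrow> \<exists>x. poly P x = 0"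
  assumes "lead_coeff P = 1" "poly P x \<in> \<mm>"
  shows "\<exists>\<zeta>. poly P \<zeta> = 0 \<and> x - \<zeta> \<in> \<mm>"
  using assms(2,3)
proof (induction "degree P" arbitrary: P)
  case 0
  then have "P = 1" by (metis monic_degree_0)
  with 0 show ?case by simp
next
  case (Suc d)
  then obtain \<zeta> where z: "poly P \<zeta> = 0" using assms(1) by (metis zero_less_Suc)
  then obtain Q where Q: "P = [:-\<zeta>, 1:] * Q" by (metis dvdE poly_eq_0_iff_dvd)
  have "Q \<noteq> 0" using Suc Q by auto
  then have "degree P = Suc (degree Q)" unfolding Q by (subst degree_mult_eq) auto
  moreover have "lead_coeff Q = 1" using Suc.prems(1) unfolding Q lead_coeff_mult by simp
  ultimately have IH: "poly Q x \<in> \<mm> \<Longrightarrow> \<exists>\<zeta>. poly Q \<zeta> = 0 \<and> x - \<zeta> \<in> \<mm>"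
    using Suc.hyps by simp
  have "(x - \<zeta>) * poly Q x \<in> \<mm>" using Suc.prems(2) by (simp add: Q algebra_simps)
  then consider "x - \<zeta> \<in> \<mm>" | "poly Q x \<in> \<mm>" using nonunit_prime by blast
  then show ?case
  proof cases
    case 2
    then show ?thesis using IH by (auto simp: Q)
  qed (use z in auto)
qed

text \<open>Without unit roots, every linear factor is dominated by one of its two terms: by the
  variable when the root is a nonunit, by the constant when the root is outside \<open>V\<close>.
  The product is then dominated by one term; its index \<open>k\<close> counts the roots in
  \<open>\<mm>\<close>, and \<open>c\<close> collects the constants.\<close>

lemma essentially_monomial:
  fixes P :: "'a poly"
  assumes closed: "\<And>P :: 'a poly. degree P > 0 \<Longrightarrow> \<exists>x. poly P x = 0"
  assumes "P \<noteq> 0" "\<And>x. poly P x = 0 \<Longrightarrow> x \<notin> V - \<mm>"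
  shows "\<exists>c k. c \<noteq> 0 \<and> coeff P k / c \<in> V - \<mm> \<and> (\<forall>i. i \<noteq> k \<longrightarrow> coeff P i / c \<in> \<mm>) \<and>
           (k > 0 \<longrightarrow> (\<exists>x\<in>V. poly P x = 0))"
  using assms(2,3)
proof (induction "degree P" arbitrary: P)
  case 0
  then obtain a where "P = [:a:]" "a \<noteq> 0" by (metis degree_eq_zeroE pCons_0_0)
  then show ?case
    by (intro exI[of _ a] exI[of _ 0]) (auto simp: coeff_pCons split: nat.splits)
next
  case (Suc d)
  then obtain \<xi> where xi: "poly P \<xi> = 0" using closed by (metis zero_less_Suc)
  then obtain Q where Q: "P = [:-\<xi>, 1:] * Q" by (metis dvdE poly_eq_0_iff_dvd)
  have "Q \<noteq> 0" using Suc Q by auto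
  then have "degree P = Suc (degree Q)" unfolding Q by (subst degree_mult_eq) auto
  moreover have "x \<notin> V - \<mm>" if "poly Q x = 0" for x using Suc.prems(2)[of x] that by (simp add: Q)
  ultimately obtain c k where IH: "c \<noteq> 0" "coeff Q k / c \<in> V - \<mm>"
    "\<And>i. i \<noteq> k \<Longrightarrow> coeff Q i / c \<in> \<mm>" "k > 0 \<Longrightarrow> \<exists>x\<in>V. poly Q x = 0"
    using Suc.hyps(1)[of Q] Suc.hyps(2) \<open>Q \<noteq> 0\<close> by auto
  have QV: "coeff Q i / c \<in> V" for i using IH(2) IH(3)[of i] nonunits_subset by blast
  have cP: "coeff P i = (if i = 0 then 0 else coeff Q (i - 1)) - \<xi> * coeff Q i" for i
    by (cases i) (auto simp: Q coeff_pCons)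
  from Suc.prems(2)[OF xi] consider "\<xi> \<in> \<mm>" | "\<xi> \<notin> V" by blast
  then show ?case
  proof cases
    case 1
    have mQ: "\<xi> * (coeff Q i / c) \<in> \<mm>" for i using 1 QV by (intro nonunit_mult)
    have "coeff P (Suc k) / c = coeff Q k / c - \<xi> * (coeff Q (Suc k) / c)"
      by (simp add: cP diff_divide_distrib)
    moreover have "coeff P i / c \<in> \<mm>" if "i \<noteq> Suc k" for i
    proof -
      have "coeff P i / c = (if i = 0 then 0 else coeff Q (i - 1) / c) - \<xi> * (coeff Q i / c)"
        by (simp add: cP diff_divide_distrib)
      moreover have "(if i = 0 then 0 else coeff Q (i - 1) / c) \<in> \<mm>" using IH(3)[of "i - 1"] that by auto
      ultimately show ?thesis using mQ[of i] nonunit_diff by simp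
    qed
    ultimately show ?thesis
      using IH unit_diff[OF IH(2) mQ[of "Suc k"]] xi 1 nonunits_subset
      by (intro exI[of _ c] exI[of _ "Suc k"]) auto
  next
    case 2
    then have nz: "\<xi> \<noteq> 0" and inv: "inverse \<xi> \<in> \<mm>" using inverse_nonunit by auto
    have eq: "coeff P i / (- \<xi> * c) = coeff Q i / c - inverse \<xi> * (if i = 0 then 0 else coeff Q (i - 1) / c)" for i
      using nz IH(1) by (simp add: cP field_simps)
    have mQ: "inverse \<xi> * (if i = 0 then 0 else coeff Q (i - 1) / c) \<in> \<mm>" for i
      using inv QV by (intro nonunit_mult) auto
    have "coeff P k / (- \<xi> * c) \<in> V - \<mm>"
      unfolding eq using IH(2) mQ[of k] by (rule unit_diff)
    moreover have "coeff P i / (- \<xi> * c) \<in> \<mm>" if "i \<noteq> k" for i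
      unfolding eq using IH(3)[OF that] mQ by (intro nonunit_diff)
    moreover have "\<exists>x\<in>V. poly P x = 0" if "k > 0" using IH(4)[OF that] by (auto simp: Q)
    ultimately show ?thesis using nz IH(1)
      by (intro exI[of _ "- \<xi> * c"] exI[of _ k]) auto
  qed
qed

text \<open>A root of valuation zero corresponds to a side of slope zero of the Newton polygon.\<close>

lemma newton_polygon_root:
  fixes P :: "'a poly"
  assumes closed: "\<And>P :: 'a poly. degree P > 0 \<Longrightarrow> \<exists>x. poly P x = 0"
  assumes PV: "\<And>i. coeff P i \<in> V" and i: "coeff P i \<notin> \<mm>" "i > 0"
  shows "\<exists>x\<in>V. poly P x = 0" "i' < i \<Longrightarrow> coeff P i' \<notin> \<mm> \<Longrightarrow> \<exists>x\<in>V - \<mm>. poly P x = 0"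
proof -
  have "P \<noteq> 0" using i by auto
  \<comment> \<open>A coefficient of \<open>P\<close> outside \<open>\<mm>\<close> can only be the
    dominant one: \<open>c\<close> itself lies in \<open>V\<close>, so the quotients in
    \<open>\<mm>\<close> stay in \<open>\<mm>\<close> after multiplication by
    \<open>c\<close>.\<close>
  have *: "j = k"
    if "c \<noteq> 0" "coeff P k / c \<in> V - \<mm>" "\<forall>i. i \<noteq> k \<longrightarrow> coeff P i / c \<in> \<mm>" "coeff P j \<notin> \<mm>" for j c k
  proof (rule ccontr)
    assume "j \<noteq> k"
    have u: "inverse (coeff P k / c) \<in> V" using that(2) inverse_mem[of "coeff P k / c"] by blast
    have "coeff P k \<noteq> 0" using that by auto
    then have "c = coeff P k * inverse (coeff P k / c)" using that by simp
    then have "c \<in> V" using u PV V_closed(4) by metis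
    then have "coeff P j / c * c \<in> \<mm>" using that(3) \<open>j \<noteq> k\<close> by (intro nonunit_mult) auto
    then show False using that by simp
  qed
  have "\<exists>c k. c \<noteq> 0 \<and> coeff P k / c \<in> V - \<mm> \<and> (\<forall>i. i \<noteq> k \<longrightarrow> coeff P i / c \<in> \<mm>) \<and>
           (k > 0 \<longrightarrow> (\<exists>x\<in>V. poly P x = 0))" if "\<not> (\<exists>x\<in>V - \<mm>. poly P x = 0)"
    using essentially_monomial[OF closed \<open>P \<noteq> 0\<close>] that by blast
  then show "\<exists>x\<in>V. poly P x = 0" "i' < i \<Longrightarrow> coeff P i' \<notin> \<mm> \<Longrightarrow> \<exists>x\<in>V - \<mm>. poly P x = 0"
    using * i by (blast, metis less_irrefl)
qed

end

section \<open>Polynomials modulo a prime vanishing at a residue\<close>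

abbreviation ipoly :: "int poly \<Rightarrow> complex \<Rightarrow> complex" where
  "ipoly U x \<equiv> poly (of_int_poly U) x"

lemma ipoly_pcompose: "ipoly (U \<circ>\<^sub>p W) x = ipoly U (ipoly W x)"
  by (simp add: of_int_hom.map_poly_pcompose poly_pcompose)

lemma int_adjoin_closed:
  shows "of_int k \<in> int_adjoin x" "x \<in> int_adjoin x"
    "u \<in> int_adjoin x \<Longrightarrow> v \<in> int_adjoin x \<Longrightarrow> u + v \<in> int_adjoin x"
    "u \<in> int_adjoin x \<Longrightarrow> v \<in> int_adjoin x \<Longrightarrow> u - v \<in> int_adjoin x"
    "u \<in> int_adjoin x \<Longrightarrow> v \<in> int_adjoin x \<Longrightarrow> u * v \<in> int_adjoin x"
    "u \<in> int_adjoin x \<Longrightarrow> v \<in> int_adjoin u \<Longrightarrow> v \<in> int_adjoin x"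
proof -
  show "of_int k \<in> int_adjoin x" unfolding int_adjoin_def by (rule range_eqI[of _ _ "[:k:]"]) (simp_all add: of_int_hom.map_poly_pCons_hom)
  show "x \<in> int_adjoin x" unfolding int_adjoin_def by (rule range_eqI[of _ _ "[:0, 1:]"]) simp
  assume "u \<in> int_adjoin x"
  then obtain U where U: "u = ipoly U x" by (auto simp: int_adjoin_def)
  { assume "v \<in> int_adjoin x"
    then obtain W where W: "v = ipoly W x" by (auto simp: int_adjoin_def)
    show "u + v \<in> int_adjoin x" unfolding int_adjoin_def
      by (rule range_eqI[of _ _ "U + W"]) (simp add: U W of_int_poly_hom.hom_add)
    show "u - v \<in> int_adjoin x" unfolding int_adjoin_def
      by (rule range_eqI[of _ _ "U - W"]) (simp add: U W of_int_poly_hom.hom_minus)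
    show "u * v \<in> int_adjoin x" unfolding int_adjoin_def
      by (rule range_eqI[of _ _ "U * W"]) (simp add: U W of_int_poly_hom.hom_mult) }
  assume "v \<in> int_adjoin u"
  then obtain W where W: "v = ipoly W u" by (auto simp: int_adjoin_def)
  show "v \<in> int_adjoin x" unfolding int_adjoin_def
    by (rule range_eqI[of _ _ "W \<circ>\<^sub>p U"]) (simp only: U W ipoly_pcompose)
qed

lemma subring_of_int_adjoin: "subring_of (int_adjoin x)"
  using int_adjoin_closed(1)[of 1] by (auto simp: subring_of_def intro: int_adjoin_closed)

lemma int_adjoin_subset:
  assumes "subring_of S" "x \<in> S"
  shows "int_adjoin x \<subseteq> S"
proof
  fix u assume "u \<in> int_adjoin x"
  then obtain U where "u = ipoly U x" by (auto simp: int_adjoin_def)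
  also have "\<dots> = (\<Sum>i\<le>degree U. of_int (coeff U i) * x ^ i)"
    by (simp add: poly_altdef degree_map_poly)
  finally show "u \<in> S"
    using assms by (auto intro!: subring_of_sum subring_ofD subring_of_of_int)
qed

lemma of_int_mod_ring_eq_0_iff: "(of_int k :: 'p::prime_card mod_ring) = 0 \<longleftrightarrow> int CARD('p) dvd k"
  by (simp add: of_int_eq_0_iff_char_dvd)

lemma of_int_poly_eq_0D:
  assumes "(of_int_poly U :: 'p::prime_card mod_ring poly) = 0"
  obtains W where "U = smult (int CARD('p)) W"
proof -
  have "int CARD('p) dvd coeff U i" for i
    using arg_cong[OF assms, of "\<lambda>f. coeff f i"] by (simp add: of_int_mod_ring_eq_0_iff)
  then have "[:int CARD('p):] dvd U" by (simp add: const_poly_dvd_iff)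
  then show ?thesis using that by (auto elim!: dvdE)
qed

definition lift_poly :: "'p::prime_card mod_ring poly \<Rightarrow> int poly" where
  "lift_poly f = map_poly to_int_mod_ring f"

lemma of_int_poly_lift [simp]: "of_int_poly (lift_poly f) = f"
  by (rule poly_eqI) (simp add: lift_poly_def coeff_map_poly of_int_of_int_mod_ring)

section \<open>Residues in a valuation ring above p\<close>

locale residue_valuation = valuation_ring V for V :: "complex set" +
  fixes tp :: "'p::prime_card itself"
  assumes p_nonunit: "of_nat CARD('p) \<in> nonunits V"
begin

abbreviation red :: "int poly \<Rightarrow> 'p mod_ring poly" where "red \<equiv> of_int_poly"

lemma int_adjoin_mem: "x \<in> V \<Longrightarrow> u \<in> int_adjoin x \<Longrightarrow> u \<in> V"
  using int_adjoin_subset[OF subring] by blast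

lemma ipoly_mem [simp]: "x \<in> V \<Longrightarrow> ipoly U x \<in> V"
  by (rule int_adjoin_mem) (auto simp: int_adjoin_def)

text \<open>An integer prime to \<open>p\<close> is a unit because a Bezout identity with
  \<open>p\<close> would otherwise put 1 into \<open>\<mm>\<close>.\<close>

lemma of_int_nonunit_iff: "of_int k \<in> \<mm> \<longleftrightarrow> int CARD('p) dvd k"
proof
  assume "int CARD('p) dvd k"
  then show "of_int k \<in> \<mm>" using p_nonunit by (auto elim!: dvdE intro!: nonunit_mult(1))
next
  assume k: "of_int k \<in> \<mm>"
  show "int CARD('p) dvd k"
  proof (rule ccontr)
    assume "\<not> int CARD('p) dvd k"
    then have "coprime (int CARD('p)) k" 
      using prime_card_int[where ?'a='p] by (simp add: prime_imp_coprime)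
    then obtain u v where "u * int CARD('p) + v * k = 1" by (metis bezout_int coprime_imp_gcd_eq_1)
    then have "of_int u * of_nat CARD('p) + of_int v * of_int k = (1::complex)"
      by (metis of_int_1 of_int_add of_int_mult of_int_of_nat_eq)
    moreover have "of_int u * of_nat CARD('p) + of_int v * of_int k \<in> \<mm>"
      using k p_nonunit by (intro nonunit_add nonunit_mult) auto
    ultimately show False by simp
  qed
qed

text \<open>For \<open>x\<close> in \<open>V\<close> this is the kernel of evaluation at the residue
  of \<open>x\<close>; the choice of lift does not affect it. A monic generator is the minimal
  polynomial of that residue over \<open>F_p\<close>.\<close>

definition vanishing :: "complex \<Rightarrow> 'p mod_ring poly set" where
  "vanishing x = {f. ipoly (lift_poly f) x \<in> \<mm>}"

lemma ipoly_red_eq_0: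
  assumes "red U = 0" "x \<in> V"
  shows "ipoly U x \<in> \<mm>"
proof -
  obtain W where "U = smult (int CARD('p)) W" using of_int_poly_eq_0D assms(1) .
  then have "ipoly U x = of_nat CARD('p) * ipoly W x" by (simp add: of_int_hom.map_poly_hom_smult)
  then show ?thesis using assms p_nonunit nonunit_mult by simp
qed

lemma ipoly_cong:
  assumes "red U = red W" "x \<in> V"
  shows "ipoly U x - ipoly W x \<in> \<mm>"
  using ipoly_red_eq_0[of "U - W" x] assms by (simp add: of_int_poly_hom.hom_minus)

lemma red_vanishing_iff: "x \<in> V \<Longrightarrow> red U \<in> vanishing x \<longleftrightarrow> ipoly U x \<in> \<mm>"
  unfolding vanishing_def mem_Collect_eq by (intro unit_cong ipoly_cong) auto

lemma ipoly_cong_arg: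
  assumes "x - y \<in> \<mm>" "x \<in> V" "y \<in> V"
  shows "ipoly U x - ipoly U y \<in> \<mm>"
proof (induction U)
  case (pCons a U)
  have "ipoly (pCons a U) x - ipoly (pCons a U) y = x * (ipoly U x - ipoly U y) + (x - y) * ipoly U y"
    by (simp add: of_int_hom.map_poly_pCons_hom algebra_simps)
  moreover have "x * (ipoly U x - ipoly U y) \<in> \<mm>" using pCons assms by (intro nonunit_mult(2))
  moreover have "(x - y) * ipoly U y \<in> \<mm>" using assms by (intro nonunit_mult(1)) auto
  ultimately show ?case using nonunit_add by simp
qed simp

lemma vanishing_cong_arg:
  assumes "x - y \<in> \<mm>" "x \<in> V" "y \<in> V"
  shows "vanishing x = vanishing y"
  unfolding vanishing_def using unit_cong[OF ipoly_cong_arg[OF assms]] by auto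

lemma vanishing_closed:
  assumes x: "x \<in> V"
  shows "f \<in> vanishing x \<Longrightarrow> g \<in> vanishing x \<Longrightarrow> f - g \<in> vanishing x"
    "f \<in> vanishing x \<Longrightarrow> f * g \<in> vanishing x"
    "f * g \<in> vanishing x \<Longrightarrow> f \<in> vanishing x \<or> g \<in> vanishing x"
    "1 \<notin> vanishing x"
proof -
  note [simp] = red_vanishing_iff[OF x] of_int_poly_hom.hom_minus of_int_poly_hom.hom_mult
  show "f \<in> vanishing x \<Longrightarrow> g \<in> vanishing x \<Longrightarrow> f - g \<in> vanishing x"
    using red_vanishing_iff[OF x, of "lift_poly f - lift_poly g"] by (simp add: vanishing_def nonunit_diff)
  have fg: "f * g \<in> vanishing x \<longleftrightarrow> ipoly (lift_poly f) x * ipoly (lift_poly g) x \<in> \<mm>"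
    using red_vanishing_iff[OF x, of "lift_poly f * lift_poly g"] by simp
  then show "f \<in> vanishing x \<Longrightarrow> f * g \<in> vanishing x"
    using x by (simp add: vanishing_def nonunit_mult)
  show "f * g \<in> vanishing x \<Longrightarrow> f \<in> vanishing x \<or> g \<in> vanishing x"
    using fg nonunit_prime by (simp add: vanishing_def)
  show "1 \<notin> vanishing x" using red_vanishing_iff[OF x, of 1] by simp
qed

text \<open>A monic element of least degree generates by division with remainder, and it is
  irreducible because the kernel is a prime ideal.\<close>

lemma vanishing_principal:
  assumes x: "x \<in> V" and f: "f \<in> vanishing x" "f \<noteq> 0"
  obtains g where "monic g" "Factorial_Ring.irreducible g" "vanishing x = {f. g dvd f}"
proof -
  note cl = vanishing_closed[OF x]
  define Q where "Q = (\<lambda>g. monic g \<and> g \<in> vanishing x)"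
  have "f * [:inverse (lead_coeff f):] \<in> vanishing x" using f by (intro cl)
  moreover have "monic (f * [:inverse (lead_coeff f):])" using f by simp
  ultimately have "Q (f * [:inverse (lead_coeff f):])" by (simp add: Q_def)
  then obtain g where g: "Q g" and min: "\<And>h. Q h \<Longrightarrow> degree g \<le> degree h"
    using arg_min_natI[of Q _ degree] arg_min_nat_le[of Q _ degree] by metis
  have g0: "g \<noteq> 0" using g by (auto simp: Q_def)
  have eq: "vanishing x = {f. g dvd f}"
  proof (intro equalityI subsetI)
    fix h assume h: "h \<in> vanishing x"
    define r where "r = h mod g"
    have "r = h - g * (h div g)" by (simp add: r_def minus_mult_div_eq_mod)
    then have r: "r \<in> vanishing x" using h g by (auto simp: Q_def intro: cl)
    have "r = 0"
    proof (rule ccontr)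
      assume "r \<noteq> 0"
      then have "Q (r * [:inverse (lead_coeff r):])" 
        using cl(2)[OF r, of "[:inverse (lead_coeff r):]"] by (simp add: Q_def)
      from min[OF this] have "degree g \<le> degree r" using \<open>r \<noteq> 0\<close> by simp
      then show False using degree_mod_less'[OF g0, of h] \<open>r \<noteq> 0\<close> by (simp add: r_def)
    qed
    then show "h \<in> {f. g dvd f}" by (simp add: r_def mod_eq_0_iff_dvd)
  qed (use g in \<open>auto simp: Q_def intro: cl elim!: dvdE\<close>)
  have "Factorial_Ring.irreducible g"
  proof (rule irreducibleI)
    show "\<not> is_unit g"
    proof
      assume "is_unit g"
      then have "1 \<in> vanishing x" using eq by auto
      then show False using cl by blast
    qed
    fix a b assume ab: "g = a * b"
    then have "a * b \<in> vanishing x" using g by (simp add: Q_def)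
    then have "g dvd a \<or> g dvd b" using cl(3)[of a b] eq by auto
    then show "is_unit a \<or> is_unit b"
    proof
      assume "g dvd a"
      then obtain c where "a = g * c" ..
      then have "g * (c * b) = g * 1" using ab by (metis mult.assoc mult.right_neutral)
      then have "b dvd 1" using g0 by (metis dvd_triv_right mult_left_cancel)
      then show ?thesis ..
    next
      assume "g dvd b"
      then obtain c where "b = g * c" ..
      then have "g * (a * c) = g * 1" using ab by (metis mult.left_commute mult.right_neutral)
      then have "a dvd 1" using g0 by (metis dvd_triv_left mult_left_cancel)
      then show ?thesis ..
    qed
  qed (use g0 in auto)
  then show ?thesis using that g eq by (auto simp: Q_def)
qed

lemma vanishing_irreducible:
  assumes x: "x \<in> V" and f: "Factorial_Ring.irreducible f" "f \<in> vanishing x"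
  shows "vanishing x = {h. f dvd h}"
proof -
  have "f \<noteq> 0" using f by auto
  then obtain g where g: "Factorial_Ring.irreducible g" "vanishing x = {f. g dvd f}"
    using vanishing_principal[OF x f(2)] by metis
  then have "g dvd f" using f by auto
  then have "f dvd g" using f g by (meson irreducibleD' irreducible_def)
  then show ?thesis using g \<open>g dvd f\<close> by (auto intro: dvd_trans)
qed

lemma vanishing_algebraic_int:
  assumes "algebraic_int x"
  obtains f where "f \<in> vanishing x" "f \<noteq> 0"
proof -
  have x: "x \<in> V" using valuation_ring_algebraic_int valuation_ring_axioms assms by blast
  obtain P where P: "ipoly P x = 0" "lead_coeff P = 1"
    using assms by (auto simp: algebraic_int_altdef_ipoly)
  have "coeff (red P) (degree P) = 1" using P by simp
  then have "red P \<noteq> 0" by (metis coeff_0 zero_neq_one)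
  moreover have "red P \<in> vanishing x" using P x by (simp add: red_vanishing_iff)
  ultimately show ?thesis using that by metis
qed

text \<open>Bounding the coefficients instead of the degree handles the zero polynomial and
  \<open>d = 0\<close> uniformly. These sets serve as representatives of the residue classes modulo
  a polynomial of degree \<open>d\<close>.\<close>

lemma card_polys_degree_less:
  "card {f :: 'p mod_ring poly. \<forall>i\<ge>d. coeff f i = 0} = CARD('p) ^ d"
  "finite {f :: 'p mod_ring poly. \<forall>i\<ge>d. coeff f i = 0}"
proof -
  let ?h = "\<lambda>f :: 'p mod_ring poly. map (coeff f) [0..<d]"
  have "bij_betw ?h {f. \<forall>i\<ge>d. coeff f i = 0} {xs. set xs \<subseteq> UNIV \<and> length xs = d}"
  proof (rule bij_betwI[of _ _ _ Poly])
    fix f :: "'p mod_ring poly" assume "f \<in> {f. \<forall>i\<ge>d. coeff f i = 0}"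
    then show "Poly (?h f) = f"
      by (intro poly_eqI) (auto simp: nth_default_def)
  next
    fix xs :: "'p mod_ring list" assume "xs \<in> {xs. set xs \<subseteq> UNIV \<and> length xs = d}"
    then show "?h (Poly xs) = xs" by (intro nth_equalityI) (auto simp: nth_default_def)
  qed (auto simp: nth_default_def)
  then have "card {f :: 'p mod_ring poly. \<forall>i\<ge>d. coeff f i = 0} = card {xs :: 'p mod_ring list. set xs \<subseteq> UNIV \<and> length xs = d}"
    and fin: "finite {f :: 'p mod_ring poly. \<forall>i\<ge>d. coeff f i = 0} = finite {xs :: 'p mod_ring list. set xs \<subseteq> UNIV \<and> length xs = d}"
    by (auto dest: bij_betw_same_card bij_betw_finite)
  then show "card {f :: 'p mod_ring poly. \<forall>i\<ge>d. coeff f i = 0} = CARD('p) ^ d"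
    by (subst (asm) card_lists_length_eq) auto
  show "finite {f :: 'p mod_ring poly. \<forall>i\<ge>d. coeff f i = 0}"
    unfolding fin by (rule finite_lists_length_eq) simp
qed

text \<open>The residue of \<open>x\<close> is a polynomial in that of \<open>y\<close>, so
  \<open>F_p[x]/(f)\<close> embeds into \<open>F_p[x]/(g)\<close>. Comparing the sizes of these
  fields compares the degrees.\<close>

lemma degree_vanishing_le:
  assumes x: "x \<in> V" "vanishing x = {h. f dvd h}" "f \<noteq> 0"
    and y: "y \<in> V" "vanishing y = {h. g dvd h}" "g \<noteq> 0"
    and cong: "x - ipoly H y \<in> \<mm>"
  shows "degree f \<le> degree g"
proof -
  define h where "h = red H"
  let ?S = "\<lambda>d. {f :: 'p mod_ring poly. \<forall>i\<ge>d. coeff f i = 0}"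
  have "inj_on (\<lambda>u. (u \<circ>\<^sub>p h) mod g) (?S (degree f))"
  proof (rule inj_onI)
    fix u v assume uv: "u \<in> ?S (degree f)" "v \<in> ?S (degree f)" "(u \<circ>\<^sub>p h) mod g = (v \<circ>\<^sub>p h) mod g"
    then have "g dvd (u - v) \<circ>\<^sub>p h" by (simp add: mod_eq_dvd_iff pcompose_diff)
    then have "(u - v) \<circ>\<^sub>p h \<in> vanishing y" using y by simp
    moreover have "(u - v) \<circ>\<^sub>p h = red (lift_poly (u - v) \<circ>\<^sub>p H)"
      by (simp add: of_int_hom.map_poly_pcompose h_def)
    ultimately have "red (lift_poly (u - v) \<circ>\<^sub>p H) \<in> vanishing y" by simp
    then have "ipoly (lift_poly (u - v)) (ipoly H y) \<in> \<mm>"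
      using y(1) by (simp only: red_vanishing_iff ipoly_pcompose)
    then have "ipoly (lift_poly (u - v)) x \<in> \<mm>"
      using unit_cong[OF ipoly_cong_arg[OF cong x(1), of "lift_poly (u - v)"]] y by simp
    then have "f dvd u - v" using x by (auto simp: vanishing_def)
    moreover have "u - v = 0 \<or> degree (u - v) < degree f"
    proof -
      have "\<forall>i\<ge>degree f. coeff (u - v) i = 0" using uv by auto
      then show ?thesis by (metis leading_coeff_0_iff not_le)
    qed
    ultimately show "u = v" using dvd_imp_degree_le[of f "u - v"] by fastforce
  qed
  moreover have "(\<lambda>u. (u \<circ>\<^sub>p h) mod g) ` ?S (degree f) \<subseteq> ?S (degree g)"
  proof -
    have "coeff (u mod g) i = 0" if "i \<ge> degree g" for u i
      using degree_mod_less'[OF y(3), of u] that by (cases "u mod g = 0") (auto intro: coeff_eq_0)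
    then show ?thesis by blast
  qed
  ultimately have "card (?S (degree f)) \<le> card (?S (degree g))"
    using card_polys_degree_less(2) by (rule card_inj_on_le)
  then have "CARD('p) ^ degree f \<le> CARD('p) ^ degree g" by (simp only: card_polys_degree_less)
  then show ?thesis using nontriv[where ?'a='p] by (simp add: power_increasing_iff)
qed

end

section \<open>Divisibility of binomial coefficients\<close>

text \<open>In \<open>j * (n choose j) = n * (n - 1 choose (j - 1))\<close> the factor
  \<open>j\<close> absorbs at most \<open>p ^ k\<close>.\<close>

lemma prime_power_dvd_binomial:
  fixes p :: nat
  assumes p: "prime p" and j: "0 < j" "j < p ^ Suc k"
  shows "p ^ (r - k) dvd (s * p ^ r choose j)"
proof (cases "k < r")
  case True
  define v where "v = multiplicity p j"
  have "p ^ v dvd j" by (simp add: v_def multiplicity_dvd)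
  then have "p ^ v < p ^ Suc k" using j dvd_imp_le[of "p ^ v" j] by linarith
  then have vk: "v \<le> k" using p prime_gt_1_nat[of p] by (metis power_less_imp_less_exp less_Suc_eq_le)
  obtain j' where j': "j = p ^ v * j'" "\<not> p dvd j'"
    using j p multiplicity_decompose'[of j p] unfolding v_def by (metis less_numeral_extra(3) not_prime_unit)
  have "j * (s * p ^ r choose j) = s * p ^ r * (s * p ^ r - 1 choose (j - 1))"
    using j by (rule_tac times_binomial_minus1_eq)
  then have "p ^ r dvd p ^ v * (j' * (s * p ^ r choose j))"
    by (simp add: j'(1)[symmetric] flip: mult.assoc)
  moreover have "p ^ r = p ^ v * p ^ (r - v)" using vk True by (simp flip: power_add)
  ultimately have "p ^ (r - v) dvd j' * (s * p ^ r choose j)"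
    using p by (simp add: prime_gt_0_nat)
  moreover have "coprime (p ^ (r - v)) j'" using p j' by (simp add: prime_imp_coprime)
  ultimately have "p ^ (r - v) dvd (s * p ^ r choose j)" by (simp add: coprime_dvd_mult_right_iff)
  then show ?thesis using vk by (meson diff_le_mono2 dvd_trans le_imp_power_dvd)
qed simp

text \<open>Passing from \<open>l\<close> to \<open>l + 1\<close> multiplies the coefficient by the
  quotient of \<open>n - (l + 1)\<close> by \<open>l + 1\<close>. Both have the same valuation, as
  \<open>l + 1 < p ^ r\<close> and \<open>p ^ r\<close> divides \<open>n\<close>.\<close>

lemma prime_not_dvd_binomial:
  fixes p :: nat
  assumes p: "prime p" and l: "l < p ^ r" "0 < s"
  shows "\<not> p dvd (s * p ^ r - 1 choose l)"
  using l(1)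
proof (induction l)
  case 0
  then show ?case using p by auto
next
  case (Suc l)
  define n where "n = s * p ^ r"
  define v where "v = multiplicity p (Suc l)"
  have "p ^ v dvd Suc l" by (simp add: v_def multiplicity_dvd)
  then have "p ^ v < p ^ r" using Suc.prems dvd_imp_le[of "p ^ v" "Suc l"] by linarith
  then have "v < r" using p prime_gt_1_nat[of p] by (metis power_less_imp_less_exp)
  then have n: "p ^ Suc v dvd n" unfolding n_def by (meson Suc_leI dvd_mult le_imp_power_dvd)
  have ln: "Suc l < n" using Suc.prems l unfolding n_def by (metis One_nat_def Suc_leI le_trans less_le_trans mult_1 mult_le_mono1)
  have nSuc: "\<not> p ^ Suc v dvd Suc l"
    using p unfolding v_def by (metis Suc_n_not_le_n Zero_not_Suc multiplicity_geI not_prime_unit)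
  show ?case
  proof
    assume *: "p dvd (s * p ^ r - 1 choose Suc l)"
    have "p ^ v * p dvd Suc l * (n - 1 choose Suc l)"
      using * \<open>p ^ v dvd Suc l\<close> unfolding n_def by (rule_tac mult_dvd_mono)
    also have "Suc l * (n - 1 choose Suc l) = (n - 1 - l) * (n - 1 choose l)"
      by (metis binomial_absorb_comp binomial_absorption)
    finally have "p ^ Suc v dvd (n - Suc l) * (n - 1 choose l)" by (simp add: mult.commute)
    moreover have "coprime (p ^ Suc v) (n - 1 choose l)"
      using Suc p unfolding n_def by (simp add: prime_imp_coprime)
    ultimately have "p ^ Suc v dvd n - Suc l" by (simp add: coprime_dvd_mult_left_iff)
    then show False using n nSuc ln by (meson dvd_diffD1 less_imp_le_nat)
  qed
qed

text \<open>Exact height of a vertex: after the absorption identity the only remaining factors are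
  \<open>s\<close> and a binomial coefficient prime to \<open>p\<close>.\<close>

lemma binomial_prime_power:
  fixes p :: nat
  assumes p: "prime p" and s: "\<not> p dvd s" and k: "k \<le> r"
  obtains u where "(s * p ^ r choose p ^ k) = p ^ (r - k) * u" "\<not> p dvd u"
proof -
  have pk: "p ^ k > 0" using p by (simp add: prime_gt_0_nat)
  define N M where "N = (s * p ^ r choose p ^ k)" and "M = (s * p ^ r - 1 choose (p ^ k - 1))"
  have "p ^ k * N = s * p ^ r * M"
    using pk unfolding N_def M_def by (rule times_binomial_minus1_eq)
  also have "\<dots> = s * (p ^ k * p ^ (r - k)) * M" using k by (simp flip: power_add)
  finally have "p ^ k * N = p ^ k * (p ^ (r - k) * (s * M))" by (simp only: ac_simps)
  then have "N = p ^ (r - k) * (s * M)" using pk by (simp only: nat_mult_eq_cancel1)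
  then have "(s * p ^ r choose p ^ k) = p ^ (r - k) * (s * (s * p ^ r - 1 choose (p ^ k - 1)))"
    unfolding N_def M_def .
  moreover have "p ^ k \<le> p ^ r" using k prime_ge_1_nat[OF p] by (rule power_increasing)
  then have "\<not> p dvd s * (s * p ^ r - 1 choose (p ^ k - 1))"
  proof -
    have "p ^ k - 1 < p ^ r" using \<open>p ^ k \<le> p ^ r\<close> pk by linarith
    moreover have "0 < s" using s by (cases s) auto
    ultimately have "\<not> p dvd (s * p ^ r - 1 choose (p ^ k - 1))" using p by (intro prime_not_dvd_binomial)
    then show ?thesis using p s by (simp add: prime_dvd_mult_iff)
  qed
  ultimately show ?thesis using that by blast
qed

text \<open>Compares an arbitrary index with the last vertex that is not to its right, so that lower
  bounds need only be checked at vertices.\<close>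

lemma prime_power_dvd_binomial_exp:
  fixes p :: nat
  assumes p: "prime p" and j: "0 < j"
  obtains l where "l \<le> r" "p ^ l \<le> j" "p ^ (r - l) dvd (s * p ^ r choose j)"
proof -
  have "2 \<le> p" "1 \<le> j" using p j by (auto simp: prime_ge_2_nat)
  then obtain l where l: "p ^ l \<le> j" "j < p ^ (l + 1)" using ex_power_ivl1 by blast
  show ?thesis
  proof (cases "l \<le> r")
    case True
    then show ?thesis using that l prime_power_dvd_binomial[OF p j, of l r s] by simp
  next
    case False
    then have "p ^ r \<le> p ^ l" using \<open>2 \<le> p\<close> by (simp add: power_increasing)
    then show ?thesis using that[of r] l by simp
  qed
qed

section \<open>Geometry of the Newton polygon\<close>

text \<open>The horizontal length of the side of the Newton polygon with right endpoint \<open>(p ^ k, r - k)\<close>;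
  the leftmost side has \<open>k = \<kappa>\<close>.\<close>

definition side_len :: "nat \<Rightarrow> nat \<Rightarrow> nat \<Rightarrow> nat" where
  "side_len p \<kappa> k = (if k = \<kappa> then p ^ \<kappa> else p ^ k - p ^ (k - 1))"

text \<open>The two strict inequalities say that a later side is longer than an earlier one, and
  longer than the abscissa of any earlier vertex; both rest on \<open>3 \<le> p\<close>. The last
  inequality says that the line through side \<open>k\<close> meets the vertical axis at height at
  most \<open>r + 1 - \<kappa>\<close>.\<close>

lemma side_len_bounds:
  assumes p: "3 \<le> p" and k: "\<kappa> \<le> k"
  shows "0 < side_len p \<kappa> k" "side_len p \<kappa> k \<le> p ^ k"
    "k \<le> j \<Longrightarrow> side_len p \<kappa> k < p ^ Suc j - p ^ j"
    "\<kappa> \<le> j \<Longrightarrow> j < k \<Longrightarrow> p ^ j < side_len p \<kappa> k"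
    "k \<le> r \<Longrightarrow> (r - k) * side_len p \<kappa> k + p ^ k \<le> (r + 1 - \<kappa>) * side_len p \<kappa> k"
proof -
  have pos: "p ^ i > 0" for i using p by simp
  have P: "3 * p ^ i \<le> p ^ Suc i" for i using p by simp
  have Q: "p ^ i \<le> p ^ j" if "i \<le> j" for i j using that p by (simp add: power_increasing)
  have e: "side_len p \<kappa> k = p ^ k - p ^ (k - 1) \<and> 3 * p ^ (k - 1) \<le> p ^ k" if "k \<noteq> \<kappa>"
    using that P[of "k - 1"] k by (cases k) (auto simp: side_len_def)
  have ek: "side_len p \<kappa> k = p ^ k" if "k = \<kappa>" using that by (simp add: side_len_def)
  show "0 < side_len p \<kappa> k" 
  proof (cases "k = \<kappa>")
    case False
    then show ?thesis using e[OF False] pos[of "k - 1"] by linarith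
  qed (use ek pos[of k] in simp)
  show le: "side_len p \<kappa> k \<le> p ^ k" using e ek by (cases "k = \<kappa>") auto
  show "k \<le> j \<Longrightarrow> side_len p \<kappa> k < p ^ Suc j - p ^ j" using le Q[of k j] P[of j] pos[of j] by linarith
  show "p ^ j < side_len p \<kappa> k" if "\<kappa> \<le> j" "j < k"
  proof -
    have "k \<noteq> \<kappa>" "j \<le> k - 1" using that by auto
    then show ?thesis using e Q[of j "k - 1"] pos[of "k - 1"] by linarith
  qed
  show "(r - k) * side_len p \<kappa> k + p ^ k \<le> (r + 1 - \<kappa>) * side_len p \<kappa> k" if "k \<le> r"
  proof (cases "k = \<kappa>")
    case True
    then have "r + 1 - \<kappa> = Suc (r - k)" using that by simp
    then show ?thesis using ek[OF True] by simp
  next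
    case False
    have "p ^ k \<le> 2 * side_len p \<kappa> k" using e[OF False] by linarith
    then have "(r - k) * side_len p \<kappa> k + p ^ k \<le> (r - k + 2) * side_len p \<kappa> k" by (simp add: algebra_simps)
    also have "\<dots> \<le> (r + 1 - \<kappa>) * side_len p \<kappa> k" using False k that by (intro mult_le_mono1) simp
    finally show ?thesis .
  qed
qed

text \<open>Convexity: the line through side \<open>k\<close> lies below all vertices. To the right,
  \<open>p ^ (l - k)\<close> is at least \<open>l - k + 1\<close>; to the left, each step down in
  the exponent decreases \<open>p ^ l\<close> by at most the length of side
  \<open>k\<close>.\<close>

lemma side_len_supporting_line:
  assumes p: "3 \<le> p" and k: "\<kappa> \<le> k" "k \<le> r" and l: "l \<le> r"
  shows "(r - k) * side_len p \<kappa> k + p ^ k \<le> (r - l) * side_len p \<kappa> k + p ^ l"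
proof (cases "k \<le> l")
  case True
  have "(l - k) * side_len p \<kappa> k + p ^ k \<le> (l - k) * p ^ k + p ^ k"
    using side_len_bounds(2)[OF p k(1)] by simp
  also have "\<dots> = Suc (l - k) * p ^ k" by simp
  also have "\<dots> \<le> p ^ (l - k) * p ^ k"
    using p less_exp[of "l - k"] power_mono[of 2 p "l - k"] by (intro mult_le_mono1) linarith
  also have "\<dots> = p ^ l" using True by (simp flip: power_add)
  moreover have "r - k = (r - l) + (l - k)" using True l by simp
  ultimately show ?thesis by (simp add: add_mult_distrib)
next
  case False
  have "p ^ k \<le> d * side_len p \<kappa> k + p ^ (k - d)" if "1 \<le> d" "d \<le> k" for d
  proof (cases "k = \<kappa>")
    case True
    then show ?thesis using that by (cases d) (auto simp: side_len_def)
  next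
    case ne: False
    then have e: "side_len p \<kappa> k = p ^ k - p ^ (k - 1)" by (simp add: side_len_def)
    show ?thesis using that
    proof (induction d rule: dec_induct)
      case base
      then show ?case by (simp add: e)
    next
      case (step d)
      then have *: "k - d = Suc (k - Suc d)" "k = Suc (k - 1)" by auto
      have "p ^ (k - Suc d) * (p - 1) \<le> p ^ (k - 1) * (p - 1)"
        using p step by (intro mult_le_mono1 power_increasing) auto
      moreover have "p ^ (k - d) = p ^ (k - Suc d) * (p - 1) + p ^ (k - Suc d)"
        using p unfolding *(1) by (simp add: algebra_simps)
      moreover have "side_len p \<kappa> k = p ^ (k - 1) * (p - 1)"
        unfolding e by (subst *(2)) (simp add: algebra_simps)
      moreover have "p ^ k \<le> d * side_len p \<kappa> k + p ^ (k - d)" using step by simp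
      ultimately show ?case unfolding mult_Suc by linarith
    qed
  qed
  from this[of "k - l"] have "p ^ k \<le> (k - l) * side_len p \<kappa> k + p ^ l" using False by simp
  moreover have "r - l = (r - k) + (k - l)" using False k by simp
  ultimately show ?thesis by (simp add: add_mult_distrib)
qed

text \<open>With \<open>X = b ^ (p - 1)\<close> the difference is \<open>b * (X ^ t - 1)\<close> for
  \<open>t = 1 + p + ... + p ^ (r - 1)\<close>. The cofactor \<open>W\<close> is a geometric sum
  congruent to \<open>t\<close>, hence to 1, modulo \<open>p\<close>. This is how the valuation of
  \<open>b ^ (p - 1) - 1\<close> becomes that of the constant term of \<open>c0\<close>.\<close>

lemma fermat_prime_power_diff:
  fixes b :: int
  assumes p: "prime p" and r: "0 < r" and b: "\<not> int p dvd b"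
  obtains W where "b ^ p ^ r - b = b * (b ^ (p - 1) - 1) * W" "\<not> int p dvd W"
proof -
  define t where "t = (\<Sum>i<r. p ^ i)"
  define X where "X = b ^ (p - 1)"
  have "int p dvd X - 1"
  proof -
    define a where "a = nat (b mod int p)"
    have a: "int a = b mod int p" using p by (simp add: a_def prime_gt_0_nat)
    then have "\<not> p dvd a" using b by (metis dvd_mod_iff dvd_refl int_dvd_int_iff)
    then have "[a ^ (p - 1) = 1] (mod p)" using p by (intro fermat_theorem)
    then have "[int a ^ (p - 1) = 1] (mod int p)" by (metis cong_int_iff of_nat_1 of_nat_power)
    moreover have "[int a = b] (mod int p)" by (simp add: a cong_def)
    then have "[int a ^ (p - 1) = X] (mod int p)" unfolding X_def by (rule cong_pow)
    ultimately have "[X = 1] (mod int p)" by (metis cong_sym cong_trans)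
    then show ?thesis by (simp add: cong_iff_dvd_diff)
  qed
  then have X: "[X = 1] (mod int p)" by (simp add: cong_iff_dvd_diff)
  define W where "W = (\<Sum>i<t. X ^ i)"
  have "p ^ r - 1 = (p - 1) * t"
  proof -
    have "int p ^ r - 1 = (int p - 1) * (\<Sum>i<r. int p ^ i)" by (rule power_diff_1_eq)
    then have "int (p ^ r - 1) = int ((p - 1) * t)"
      using prime_gt_0_nat[OF p] by (simp add: t_def of_nat_diff)
    then show ?thesis by (simp only: of_nat_eq_iff)
  qed
  then have pr: "p ^ r = Suc ((p - 1) * t)" using prime_gt_0_nat[OF p] by (metis Suc_pred' zero_less_power)
  have "b ^ p ^ r - b = b * (X ^ t - 1)"
    unfolding pr X_def by (simp only: power_Suc power_mult right_diff_distrib mult_1_right)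
  also have "\<dots> = b * (X - 1) * W" unfolding power_diff_1_eq[of X t] W_def by simp
  finally have 1: "b ^ p ^ r - b = b * (b ^ (p - 1) - 1) * W" by (simp add: X_def)
  have "[W = (\<Sum>i<t. 1 ^ i)] (mod int p)" unfolding W_def by (intro cong_sum cong_pow X)
  then have W: "[W = int t] (mod int p)" by simp
  obtain q where "r = Suc q" using r by (cases r) auto
  then have "t = 1 + p * (\<Sum>i<q. p ^ i)"
    unfolding t_def by (simp add: sum.lessThan_Suc_shift sum_distrib_left del: sum.lessThan_Suc)
  then have "[W = 1 + int p * int (\<Sum>i<q. p ^ i)] (mod int p)" using W by (metis of_nat_1 of_nat_add of_nat_mult)
  then have "[W = 1] (mod int p)" by (simp add: cong_def)
  then have "\<not> int p dvd W" using p by (metis cong_dvd_iff dvd_refl int_dvd_int_iff not_prime_unit of_nat_1)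
  with 1 that show ?thesis by blast
qed

section \<open>A discrete valuation ring with residue field generated by one element\<close>

text \<open>For \<open>G\<close> inside \<open>V\<close> this is the localisation of
  \<open>\<int>[G]\<close> at the prime below the maximal ideal of \<open>V\<close>. The inductive
  form lets congruences be propagated through each ring operation and each inverse.\<close>

inductive_set local_closure :: "complex set \<Rightarrow> complex set \<Rightarrow> complex set" for V G where
  gen: "x \<in> G \<Longrightarrow> x \<in> local_closure V G"
| one: "1 \<in> local_closure V G"
| diff: "x \<in> local_closure V G \<Longrightarrow> y \<in> local_closure V G \<Longrightarrow> x - y \<in> local_closure V G"
| mult: "x \<in> local_closure V G \<Longrightarrow> y \<in> local_closure V G \<Longrightarrow> x * y \<in> local_closure V G"
| inv: "x \<in> local_closure V G \<Longrightarrow> inverse x \<in> V \<Longrightarrow> inverse x \<in> local_closure V G"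

lemma subring_of_local_closure: "subring_of (local_closure V G)"
  by (auto simp: subring_of_def intro: local_closure.intros)

lemma clear_denominators:
  fixes f :: "rat poly"
  obtains d U where "d \<noteq> 0" "of_int d * poly (map_poly of_rat f) x = ipoly U x"
proof -
  have "\<exists>d U. d \<noteq> 0 \<and> of_int d * poly (map_poly of_rat f) x = ipoly U x"
  proof (induction f)
    case 0
    show ?case by (intro exI[of _ 1] exI[of _ 0]) simp
  next
    case (pCons a f)
    then obtain d U where dU: "d \<noteq> 0" "of_int d * poly (map_poly of_rat f) x = ipoly U x" by blast
    obtain n m where nm: "quotient_of a = (n, m)" by fastforce
    then have m: "m > 0" "a = of_int n / of_int m" by (auto simp: quotient_of_denom_pos quotient_of_div)
    then have "of_int m * of_rat a = (of_int n :: complex)" by (simp add: of_rat_divide)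
    then have "of_int (d * m) * poly (map_poly of_rat (pCons a f)) x
        = of_int (d * n) + of_int m * x * (of_int d * poly (map_poly of_rat f) x)"
      by (simp add: of_rat_hom.map_poly_pCons_hom algebra_simps)
    also have "\<dots> = ipoly ([:d * n:] + [:0, m:] * U) x"
      unfolding dU(2) by (simp add: of_int_hom.map_poly_pCons_hom of_int_poly_hom.hom_add of_int_poly_hom.hom_mult
          of_int_hom.map_poly_hom_smult)
    finally show ?case using dU m by (intro exI[of _ "d * m"]) auto
  qed
  then show ?thesis using that by blast
qed

context residue_valuation
begin

lemma local_closure_subset:
  assumes "G \<subseteq> V"
  shows "local_closure V G \<subseteq> V"
proof
  fix x assume "x \<in> local_closure V G"
  then show "x \<in> V" using assms by induction auto
qed

text \<open>The hypotheses say that \<open>\<pi>\<close> generates the maximal ideal of the local ring \<open>L\<close>: modulo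
  \<open>\<pi>\<close> the prime number and \<open>\<phi>(\<theta>)\<close> vanish and \<open>Y\<close> is congruent to an element of \<open>\<int>[\<theta>]\<close>. Hence
  \<open>L\<close> is a discrete valuation ring containing every element of \<open>\<rat>(\<theta>)\<close> that lies in \<open>V\<close>.\<close>

lemma residue_in_int_adjoin:
  fixes \<theta> Y \<pi> u :: complex and \<phi> :: "'p mod_ring poly"
  defines "L \<equiv> local_closure V {\<theta>, Y}"
  defines "D \<equiv> (*) \<pi> ` L"
  assumes V: "\<theta> \<in> V" "Y \<in> V"
    and pi: "\<pi> \<in> L" "\<pi> \<in> \<mm>"
    and p: "of_nat CARD('p) = \<pi> ^ e * u" "0 < e" "u \<in> L" "inverse u \<in> V"
    and Y: "of_int c * Y + w \<in> D" "w \<in> int_adjoin \<theta>" "\<not> int CARD('p) dvd c"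
    and phi: "Factorial_Ring.irreducible \<phi>" "\<phi> \<in> vanishing \<theta>" "ipoly (lift_poly \<phi>) \<theta> \<in> D"
    and rho: "\<rho> \<in> V" "\<rho> = poly (map_poly of_rat f) \<theta>"
  obtains H where "\<rho> - ipoly H \<theta> \<in> \<mm>"
proof -
  have sL: "subring_of L" unfolding L_def by (rule subring_of_local_closure)
  note Lc = subring_ofD[OF sL] subring_of_of_int[OF sL] subring_of_of_nat[OF sL]
  have LV: "L \<subseteq> V" unfolding L_def using V by (intro local_closure_subset) auto
  have thL: "\<theta> \<in> L" "Y \<in> L" unfolding L_def by (auto intro: local_closure.gen)
  have Linv: "inverse x \<in> L" if "x \<in> L" "inverse x \<in> V" for x
    using that unfolding L_def by (rule local_closure.inv)
  have aL: "int_adjoin \<theta> \<subseteq> L" using sL thL by (intro int_adjoin_subset)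
  then have iL: "ipoly U \<theta> \<in> L" for U by (auto simp: int_adjoin_def)
  have Dm: "D \<subseteq> \<mm>" using pi LV unfolding D_def by (auto intro!: nonunit_mult(1))
  have DI: "\<pi> * x \<in> D" if "x \<in> L" for x using that by (auto simp: D_def)
  have Dmult: "x * y \<in> D" "y * x \<in> D" if xy: "x \<in> D" "y \<in> L" for x y
  proof -
    obtain z where z: "x = \<pi> * z" "z \<in> L" using xy by (auto simp: D_def)
    show "x * y \<in> D" using DI[of "z * y"] Lc(4) z xy by (simp add: mult.assoc)
    then show "y * x \<in> D" by (simp add: mult.commute)
  qed
  have Dadd: "x + y \<in> D" "x - y \<in> D" if xy: "x \<in> D" "y \<in> D" for x y
  proof -
    obtain z w where "x = \<pi> * z" "z \<in> L" "y = \<pi> * w" "w \<in> L" using xy by (auto simp: D_def)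
    then show "x + y \<in> D" "x - y \<in> D"
      using DI[of "z + w"] DI[of "z - w"] Lc(3,6) by (simp_all add: algebra_simps)
  qed
  have D0: "0 \<in> D" unfolding D_def using Lc by (auto simp: image_iff intro!: bexI[of _ 0])
  have pD: "of_nat CARD('p) \<in> D"
  proof -
    obtain e' where "e = Suc e'" using p(2) by (cases e) auto
    then have "of_nat CARD('p) = \<pi> * (\<pi> ^ e' * u)" using p(1) by simp
    then show ?thesis using DI[of "\<pi> ^ e' * u"] Lc(4)[OF Lc(7)[OF pi(1)] p(3)] by metis
  qed
  have redD: "ipoly U \<theta> \<in> D" if "red U = 0" for U
  proof -
    obtain W where "U = smult (int CARD('p)) W" using of_int_poly_eq_0D \<open>red U = 0\<close> .
    then have "ipoly U \<theta> = of_nat CARD('p) * ipoly W \<theta>" by (simp add: of_int_hom.map_poly_hom_smult)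
    then show ?thesis using pD iL Dmult by simp
  qed
  \<comment> \<open>Inverting \<open>c\<close> modulo \<open>p\<close> turns the congruence for
    \<open>c * Y\<close> into one for \<open>Y\<close>, with representative \<open>h\<close> in
    \<open>\<int>[\<theta>]\<close>.\<close>
  have "coprime c (int CARD('p))"
    using Y(3) prime_card_int[where ?'a='p] prime_imp_coprime coprime_commute by blast
  then obtain c' k where "c' * c + k * int CARD('p) = 1" by (metis bezout_int coprime_imp_gcd_eq_1)
  then have "c' * c = 1 - k * int CARD('p)" by linarith
  then have c': "of_int c' * of_int c = (1::complex) - of_int k * of_nat CARD('p)"
    by (metis of_int_1 of_int_diff of_int_mult of_int_of_nat_eq)
  define h where "h = - (of_int c' * w)"
  have hA: "h \<in> int_adjoin \<theta>"
    using Y(2) subring_ofD[OF subring_of_int_adjoin] int_adjoin_closed(1) by (simp add: h_def)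
  have "of_int c' * (of_int c * Y + w) + of_nat CARD('p) * (of_int k * Y)
      = of_int c' * of_int c * Y + of_int k * of_nat CARD('p) * Y + of_int c' * w"
    by (simp only: algebra_simps)
  also have "\<dots> = Y - h" unfolding c' h_def by (simp only: algebra_simps) simp
  finally have "Y - h = of_int c' * (of_int c * Y + w) + of_nat CARD('p) * (of_int k * Y)" ..
  moreover have "of_int k * Y \<in> L" by (intro Lc(4) Lc(8) thL)
  ultimately have Yh: "Y - h \<in> D"
    using Dadd(1)[OF Dmult(2)[OF Y(1) Lc(8)[of c']] Dmult(1)[OF pD]] by metis
  have van: "vanishing \<theta> = {h. \<phi> dvd h}" using V phi by (intro vanishing_irreducible)
  \<comment> \<open>Modulo \<pi> the ring \<open>L\<close> has no residues beyond those of
    \<open>\<int>[\<theta>]\<close>.\<close>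
  have step1: "\<exists>h\<in>int_adjoin \<theta>. x - h \<in> D" if "x \<in> L" for x
    using that unfolding L_def
  proof induction
    case (gen x)
    then show ?case using Yh hA D0 int_adjoin_closed(2)[of \<theta>] by (auto intro: bexI[of _ \<theta>])
  next
    case one
    show ?case using D0 int_adjoin_closed(1)[of 1] by (intro bexI[of _ 1]) auto
  next
    case (diff x y)
    then obtain h k where "h \<in> int_adjoin \<theta>" "x - h \<in> D" "k \<in> int_adjoin \<theta>" "y - k \<in> D" by auto
    then show ?case using Dadd(2)[of "x - h" "y - k"]
      by (intro bexI[of _ "h - k"]) (auto intro: int_adjoin_closed simp: algebra_simps)
  next
    case (mult x y)
    then obtain h k where hk: "h \<in> int_adjoin \<theta>" "x - h \<in> D" "k \<in> int_adjoin \<theta>" "y - k \<in> D" by auto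
    have "x * (y - k) + k * (x - h) \<in> D"
      using hk mult aL unfolding L_def[symmetric] by (intro Dadd(1) Dmult(2)) auto
    then show ?case using hk
      by (intro bexI[of _ "h * k"]) (auto intro: int_adjoin_closed simp: algebra_simps)
  next
    case (inv x)
    then obtain h where h: "h \<in> int_adjoin \<theta>" "x - h \<in> D" by auto
    show ?case
    proof (cases "x = 0")
      case True
      then show ?thesis using D0 int_adjoin_closed(1)[of 0] by (auto intro!: bexI[of _ 0])
    next
      case False
      then have "x \<notin> \<mm>" using inv by (auto simp: nonunits_def)
      then have "h \<notin> \<mm>" using h Dm unit_cong by blast
      moreover obtain U where U: "h = ipoly U \<theta>" using h by (auto simp: int_adjoin_def)
      ultimately have "red U \<notin> vanishing \<theta>" using V by (simp add: red_vanishing_iff)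
      then have "\<not> \<phi> dvd red U" by (simp add: van)
      then have "coprime \<phi> (red U)" 
        using phi(1) by (intro prime_elem_imp_coprime irreducible_imp_prime_elem_gcd)
      \<comment> \<open>A Bezout identity in \<open>F_p[x]\<close> inverts the reduction of
        \<open>U\<close> modulo \<phi>; since \<phi>(\<theta>) and \<open>p\<close> lie in
        \<open>D\<close>, the polynomial \<open>B\<close> represents the inverse.\<close>
      then obtain A B where AB: "A * \<phi> + B * red U = 1" 
        by (metis bezout_coefficients_fst_snd coprime_imp_gcd_eq_1)
      define h' where "h' = ipoly (lift_poly B) \<theta>"
      have "red (1 - lift_poly A * lift_poly \<phi> - lift_poly B * U) = 0"
        unfolding of_int_poly_hom.hom_minus of_int_poly_hom.hom_mult of_int_poly_lift of_int_poly_hom.hom_one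
          AB[symmetric] by simp
      from redD[OF this] have "1 - ipoly (lift_poly A) \<theta> * ipoly (lift_poly \<phi>) \<theta> - h' * h \<in> D"
        by (simp add: of_int_poly_hom.hom_minus of_int_poly_hom.hom_mult U h'_def)
      from Dadd(1)[OF this Dmult(2)[OF phi(3) iL[of "lift_poly A"]]] have 1: "1 - h' * h \<in> D" by simp
      have "(1 - h' * h) - (x - h) * h' \<in> D"
        using Dadd(2)[OF 1 Dmult(1)[OF h(2) iL[of "lift_poly B"]]] by (simp only: h'_def)
      then have "((1 - h' * h) - (x - h) * h') * inverse x \<in> D"
        using Linv inv unfolding L_def[symmetric] by (intro Dmult(1)[of _ "inverse x"])
      moreover have "((1 - h' * h) - (x - h) * h') * inverse x = inverse x - h'"
        using False by (simp add: field_simps)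
      ultimately show ?thesis by (auto simp: h'_def int_adjoin_def)
    qed
  qed
  \<comment> \<open>\<pi> generates the maximal ideal: a nonunit is congruent modulo
    \<open>D\<close> to an integer polynomial in \<theta> whose reduction is divisible by
    \<phi>.\<close>
  have step2: "x \<in> D" if x: "x \<in> L" "x \<in> \<mm>" for x
  proof -
    obtain h where h: "h \<in> int_adjoin \<theta>" "x - h \<in> D" using step1 x by blast
    then obtain U where U: "h = ipoly U \<theta>" by (auto simp: int_adjoin_def)
    have "h \<in> \<mm>" using h Dm x unit_cong by blast
    then have "\<phi> dvd red U" using U V van by (auto simp: red_vanishing_iff[symmetric])
    then obtain B where B: "red U = \<phi> * B" by blast
    have "red (U - lift_poly \<phi> * lift_poly B) = 0"
      using B by (simp add: of_int_poly_hom.hom_minus of_int_poly_hom.hom_mult)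
    from redD[OF this] have "h - ipoly (lift_poly \<phi>) \<theta> * ipoly (lift_poly B) \<theta> \<in> D"
      by (simp add: of_int_poly_hom.hom_minus of_int_poly_hom.hom_mult U)
    from Dadd(1)[OF this Dmult(1)[OF phi(3) iL[of "lift_poly B"]]] have "h \<in> D" by simp
    from Dadd(1)[OF h(2) this] show ?thesis by simp
  qed
  have "of_nat CARD('p) \<noteq> (0::complex)" by simp
  then have nz: "\<pi> \<noteq> 0" "u \<noteq> 0" using p(1,2) by auto
  have step3: "\<rho> \<in> L" if "\<pi> ^ l * \<rho> \<in> L" for l
    using that
  proof (induction l)
    case (Suc l)
    have "\<pi> * (\<pi> ^ l * \<rho>) \<in> \<mm>" using pi LV rho by (intro nonunit_mult) auto
    then have "\<pi> ^ Suc l * \<rho> \<in> D" using Suc.prems by (intro step2) (auto simp: mult.assoc)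
    then obtain y where "y \<in> L" "\<pi> ^ Suc l * \<rho> = \<pi> * y" by (auto simp: D_def)
    then have "\<pi> ^ l * \<rho> \<in> L" using nz by simp
    then show ?case by (rule Suc.IH)
  qed simp
  obtain d U where dU: "d \<noteq> 0" "of_int d * \<rho> = ipoly U \<theta>"
    using clear_denominators[of f \<theta>] unfolding rho(2)[symmetric] by blast
  \<comment> \<open>The prime-to-\<open>p\<close> part of the denominator is invertible in
    \<open>L\<close>, and its \<open>p\<close>-part is a power of \<pi> up to a unit, which
    \<open>step3\<close> cancels.\<close>
  obtain d' where d': "d = int CARD('p) ^ multiplicity (int CARD('p)) d * d'" "\<not> int CARD('p) dvd d'"
    using multiplicity_decompose'[of d "int CARD('p)"] dU(1) prime_card_int[where ?'a='p] by (metis not_prime_unit)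
  define k where "k = multiplicity (int CARD('p)) d"
  have d'0: "d' \<noteq> 0" using d' by auto
  have "inverse (of_int d') \<in> V" using d'(2) by (intro inverse_mem) (auto simp: of_int_nonunit_iff)
  then have d'L: "inverse (of_int d') \<in> L" using Lc by (intro Linv)
  have "of_int d = of_nat CARD('p) ^ k * (of_int d' :: complex)"
    by (subst d'(1)) (simp add: k_def)
  then have "\<pi> ^ (e * k) * \<rho> = ipoly U \<theta> * inverse (of_int d') * inverse u ^ k"
    using dU(2) d'0 nz unfolding p(1) by (simp add: power_mult power_mult_distrib field_simps)
  also have "\<dots> \<in> L" by (intro Lc(4) Lc(7) iL d'L Linv p)
  finally have "\<rho> \<in> L" by (rule step3)
  then obtain h where "h \<in> int_adjoin \<theta>" "\<rho> - h \<in> D" using step1 by blast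
  then show ?thesis using that Dm by (auto simp: int_adjoin_def)
qed

end

section \<open>The Newton polygon of a trinomial\<close>

text \<open>With \<open>y = x ^ s + b\<close> the equation \<open>x ^ (s * p ^ r) + a * x + b = 0\<close> reads
  \<open>(\<Sum>j=1..p^r. C j * y ^ j) + c0 x = 0\<close>. The principal Newton polygon of this equation has the
  vertices \<open>(p ^ k, r - k)\<close> for \<open>\<kappa> \<le> k \<le> r\<close> and starts at height at least \<open>r + 1 - \<kappa>\<close>. The element
  \<open>z k\<close> is the quotient of Ore's theory attached to the vertex \<open>p ^ k\<close>.\<close>

locale trinomial =
  fixes p s r \<kappa> :: nat and a b :: int
  assumes prime_p: "prime p" and odd_p: "odd p" and s: "\<not> p dvd s" and b: "\<not> int p dvd b"
    and \<kappa>: "\<kappa> \<le> r"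
    and a_dvd: "int p ^ (r + 1 - \<kappa>) dvd a"
    and c0_dvd: "int p ^ (r + 1 - \<kappa>) dvd (-b) ^ p ^ r + b"
begin

definition C :: "nat \<Rightarrow> int" where
  "C j = int (p ^ r choose j) * (-b) ^ (p ^ r - j)"

definition y :: "complex \<Rightarrow> complex" where
  "y x = x ^ s + of_int b"

definition c0 :: "int poly" where
  "c0 = [:(-b) ^ p ^ r + b, a:]"

definition u :: "nat \<Rightarrow> int" where
  "u k = C (p ^ k) div int p ^ (r - k)"

text \<open>The terms of \<open>z k\<close> before the next vertex. The integer division is exact on
  this range of indices.\<close>

definition A :: "nat \<Rightarrow> complex \<Rightarrow> complex" where
  "A k x = (\<Sum>j\<in>{p ^ k..<p ^ Suc k}. of_int (C j div int p ^ (r - k)) * y x ^ (j - p ^ k))"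

text \<open>The terms to the left of vertex \<open>k\<close>, including \<open>c0\<close>. The
  exponent \<open>r + 1 - k\<close> exceeds the height of the vertex by one, and all these terms are
  divisible by that power when \<open>\<kappa> \<le> k\<close>.\<close>

definition l :: "nat \<Rightarrow> complex \<Rightarrow> complex" where
  "l k x = (ipoly c0 x + (\<Sum>j\<in>{1..<p ^ k}. of_int (C j) * y x ^ j)) / of_nat p ^ (r + 1 - k)"

definition z :: "nat \<Rightarrow> complex \<Rightarrow> complex" where
  "z k x = (\<Sum>j\<in>{p ^ k..p ^ r}. of_int (C j) * y x ^ (j - p ^ k)) / of_nat p ^ (r - k)"

definition is_root :: "complex \<Rightarrow> bool" where
  "is_root x \<longleftrightarrow> x ^ (s * p ^ r) + of_int a * x + of_int b = 0"

lemma p3: "3 \<le> p"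
  using prime_p odd_p prime_ge_2_nat[of p] by (cases "p = 2") auto

lemma p_pos [simp]: "0 < p" "p \<noteq> 0"
  using p3 by auto

lemma p_power_le: "i \<le> j \<Longrightarrow> p ^ i \<le> p ^ j"
  using p3 by (simp add: power_increasing)

lemma p_power_less: "i < j \<Longrightarrow> p ^ i < p ^ j"
  using p3 by (simp add: power_strict_increasing)

lemma C_dvd: 
  assumes "0 < j" "j < p ^ Suc k"
  shows "int p ^ (r - k) dvd C j"
  using prime_power_dvd_binomial[OF prime_p assms, of r 1]
  by (auto simp: C_def simp flip: of_nat_power)

lemma of_int_div:
  assumes "int p ^ i dvd m"
  shows "of_int (m div int p ^ i) = (of_int m / of_nat p ^ i :: complex)"
  using assms by (auto elim!: dvdE)

lemma u_unit:
  assumes "k \<le> r"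
  shows "\<not> int p dvd u k" "of_int (u k) = (of_int (C (p ^ k)) / of_nat p ^ (r - k) :: complex)"
proof -
  have "\<not> p dvd 1" using prime_p by auto
  then obtain t where t: "(p ^ r choose p ^ k) = p ^ (r - k) * t" "\<not> p dvd t"
    using binomial_prime_power[OF prime_p _ assms, of 1] by auto
  have C: "C (p ^ k) = int p ^ (r - k) * (int t * (-b) ^ (p ^ r - p ^ k))"
    by (simp add: C_def t(1))
  have "prime (int p)" using prime_p by simp
  then show "\<not> int p dvd u k" unfolding u_def C
    using t(2) b prime_dvd_power[of "int p" "- b"] by (auto simp: prime_dvd_mult_iff)
  have "int p ^ (r - k) dvd C (p ^ k)" by (simp add: C)
  then show "of_int (u k) = (of_int (C (p ^ k)) / of_nat p ^ (r - k) :: complex)"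
    unfolding u_def by (rule of_int_div)
qed

lemma z_top: "z r x = 1"
  by (simp add: z_def C_def)

lemma u_top: "u r = 1"
  by (simp add: u_def C_def)

lemma A_eq:
  "A k x = (\<Sum>j\<in>{p ^ k..<p ^ Suc k}. of_int (C j) * y x ^ (j - p ^ k)) / of_nat p ^ (r - k)"
  unfolding A_def sum_divide_distrib
proof (intro sum.cong refl)
  fix j assume "j \<in> {p ^ k..<p ^ Suc k}"
  then have "int p ^ (r - k) dvd C j" using p_power_le[of 0 k] by (intro C_dvd) auto
  then show "of_int (C j div int p ^ (r - k)) * y x ^ (j - p ^ k) = of_int (C j) * y x ^ (j - p ^ k) / of_nat p ^ (r - k)"
    by (simp add: of_int_div)
qed

text \<open>Splits the sum at the next vertex. For \<open>\<kappa> \<le> k\<close> the exponent of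
  \<open>y x\<close> is the length of side \<open>Suc k\<close>, so the factor before
  \<open>z (Suc k) x\<close> is the quantity that is a unit at roots on that side.\<close>

lemma z_step:
  assumes "k < r"
  shows "z k x = A k x + y x ^ (p ^ Suc k - p ^ k) / of_nat p * z (Suc k) x"
proof -
  let ?f = "\<lambda>j. of_int (C j) * y x ^ (j - p ^ k)"
  have le: "p ^ k \<le> p ^ Suc k" "p ^ Suc k \<le> p ^ r" using assms by (intro p_power_le; simp)+
  have "{p ^ k..p ^ r} = {p ^ k..<p ^ Suc k} \<union> {p ^ Suc k..p ^ r}"
    using le by (auto simp del: power_Suc)
  then have "sum ?f {p ^ k..p ^ r} = sum ?f {p ^ k..<p ^ Suc k} + sum ?f {p ^ Suc k..p ^ r}"
    by (simp only:) (rule sum.union_disjoint; auto)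
  also have "sum ?f {p ^ Suc k..p ^ r}
      = y x ^ (p ^ Suc k - p ^ k) * (\<Sum>j\<in>{p ^ Suc k..p ^ r}. of_int (C j) * y x ^ (j - p ^ Suc k))"
    unfolding sum_distrib_left
  proof (intro sum.cong refl)
    fix j assume "j \<in> {p ^ Suc k..p ^ r}"
    then have "j - p ^ k = (p ^ Suc k - p ^ k) + (j - p ^ Suc k)" using le by auto
    then show "?f j = y x ^ (p ^ Suc k - p ^ k) * (of_int (C j) * y x ^ (j - p ^ Suc k))"
      by (simp only: power_add ac_simps)
  qed
  finally show ?thesis
    using assms by (simp add: z_def A_eq add_divide_distrib Suc_diff_Suc[symmetric] del: power_Suc)
      (simp add: power_Suc)
qed

lemma A_mem: "A k x \<in> int_adjoin x"
  and A_cong: "\<exists>t\<in>int_adjoin x. A k x - of_int (u k) = y x * t"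
proof -
  note S = subring_ofD[OF subring_of_int_adjoin[of x]] subring_of_of_int[OF subring_of_int_adjoin[of x]]
    subring_of_sum[OF subring_of_int_adjoin[of x]] int_adjoin_closed(2)[of x]
  have yS: "y x \<in> int_adjoin x" by (auto simp: y_def intro!: S)
  show "A k x \<in> int_adjoin x" using yS by (auto simp: A_def intro!: S)
  have "{p ^ k..<p ^ Suc k} = insert (p ^ k) {p ^ k<..<p ^ Suc k}"
    using p_power_less[of k "Suc k"] by auto
  then have "A k x - of_int (u k)
      = (\<Sum>j\<in>{p ^ k<..<p ^ Suc k}. of_int (C j div int p ^ (r - k)) * y x ^ (j - p ^ k))"
    by (simp add: A_def u_def del: power_Suc)
  also have "\<dots> = y x * (\<Sum>j\<in>{p ^ k<..<p ^ Suc k}. of_int (C j div int p ^ (r - k)) * y x ^ (j - p ^ k - 1))"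
    unfolding sum_distrib_left
  proof (intro sum.cong refl)
    fix j assume "j \<in> {p ^ k<..<p ^ Suc k}"
    then have "j - p ^ k = Suc (j - p ^ k - 1)" by auto
    then show "of_int (C j div int p ^ (r - k)) * y x ^ (j - p ^ k)
        = y x * (of_int (C j div int p ^ (r - k)) * y x ^ (j - p ^ k - 1))"
      by (metis mult.left_commute power_Suc)
  qed
  finally show "\<exists>t\<in>int_adjoin x. A k x - of_int (u k) = y x * t"
    using yS by (auto intro!: S)
qed

lemma l_mem:
  assumes "\<kappa> \<le> k" "k \<le> r"
  shows "l k x \<in> int_adjoin x"
proof -
  note S = subring_ofD[OF subring_of_int_adjoin[of x]] subring_of_of_int[OF subring_of_int_adjoin[of x]]
    subring_of_sum[OF subring_of_int_adjoin[of x]] int_adjoin_closed(2)[of x]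
  let ?N = "r + 1 - k"
  have yS: "y x \<in> int_adjoin x" by (auto simp: y_def intro!: S)
  have le: "int p ^ ?N dvd int p ^ (r + 1 - \<kappa>)" using assms by (intro le_imp_power_dvd) simp
  have d: "int p ^ ?N dvd (-b) ^ p ^ r + b" "int p ^ ?N dvd a"
    using le a_dvd c0_dvd dvd_trans by blast+
  have Cd: "int p ^ ?N dvd C j" if "j \<in> {1..<p ^ k}" for j
  proof (cases k)
    case 0
    then show ?thesis using that by simp
  next
    case (Suc k')
    then have "?N = r - k'" using assms by simp
    then show ?thesis using C_dvd[of j k'] that Suc by simp
  qed
  have "l k x = of_int ((-b) ^ p ^ r + b) / of_nat p ^ ?N + of_int a / of_nat p ^ ?N * x
      + (\<Sum>j\<in>{1..<p ^ k}. of_int (C j) / of_nat p ^ ?N * y x ^ j)"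
    by (simp add: l_def c0_def of_int_hom.map_poly_pCons_hom add_divide_distrib sum_divide_distrib mult.commute)
  also have "\<dots> = of_int (((-b) ^ p ^ r + b) div int p ^ ?N) + of_int (a div int p ^ ?N) * x
      + (\<Sum>j\<in>{1..<p ^ k}. of_int (C j div int p ^ ?N) * y x ^ j)"
    using d Cd by (simp add: of_int_div del: of_int_add of_int_power)
  also have "\<dots> \<in> int_adjoin x" using yS by (auto intro!: S)
  finally show ?thesis .
qed

text \<open>The equation of the root, expanded in \<open>y x\<close>, is split at vertex
  \<open>k\<close> and divided by \<open>p ^ (r - k)\<close>. The factor \<open>p\<close> on the
  right is the additional power divided out in \<open>l\<close>.\<close>

lemma z_l:
  assumes x: "is_root x" and k: "k \<le> r"
  shows "y x ^ p ^ k * z k x = - (of_nat p * l k x)"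
proof -
  let ?f = "\<lambda>j. of_int (C j) * y x ^ j"
  have pk: "1 \<le> p ^ k" "p ^ k \<le> p ^ r" using p_power_le[of 0 k] p_power_le[OF k] by auto
  have "x ^ (s * p ^ r) = (y x + of_int (-b)) ^ p ^ r"
    by (simp add: y_def power_mult)
  also have "\<dots> = (\<Sum>j\<le>p ^ r. ?f j)"
    by (subst binomial_ring) (simp add: C_def ac_simps)
  also have "{..p ^ r} = insert 0 ({1..<p ^ k} \<union> {p ^ k..p ^ r})" using pk by auto
  also have "sum ?f (insert 0 ({1..<p ^ k} \<union> {p ^ k..p ^ r})) = ?f 0 + sum ?f ({1..<p ^ k} \<union> {p ^ k..p ^ r})"
    using pk by (intro sum.insert) auto
  also have "sum ?f ({1..<p ^ k} \<union> {p ^ k..p ^ r}) = sum ?f {1..<p ^ k} + sum ?f {p ^ k..p ^ r}"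
    by (rule sum.union_disjoint) auto
  also have "sum ?f {p ^ k..p ^ r} = y x ^ p ^ k * (of_nat p ^ (r - k) * z k x)"
  proof -
    have "of_nat p ^ (r - k) * z k x = (\<Sum>j\<in>{p ^ k..p ^ r}. of_int (C j) * y x ^ (j - p ^ k))"
      by (simp add: z_def)
    moreover have "?f j = y x ^ p ^ k * (of_int (C j) * y x ^ (j - p ^ k))" if "j \<in> {p ^ k..p ^ r}" for j
      using that by (simp add: mult.left_commute flip: power_add)
    then have "sum ?f {p ^ k..p ^ r} = (\<Sum>j\<in>{p ^ k..p ^ r}. y x ^ p ^ k * (of_int (C j) * y x ^ (j - p ^ k)))"
      by (rule sum.cong[OF refl])
    ultimately show ?thesis by (simp add: sum_distrib_left)
  qed
  also have "sum ?f {1..<p ^ k} = of_nat p ^ (r + 1 - k) * l k x - ipoly c0 x"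
    by (simp add: l_def)
  also have "?f 0 = of_int ((-b) ^ p ^ r)" by (simp add: C_def)
  finally have "x ^ (s * p ^ r) = of_int ((-b) ^ p ^ r) + (of_nat p ^ (r + 1 - k) * l k x - ipoly c0 x +
      y x ^ p ^ k * (of_nat p ^ (r - k) * z k x))" .
  moreover have "ipoly c0 x = of_int ((-b) ^ p ^ r) + of_int b + of_int a * x"
    by (simp add: c0_def of_int_hom.map_poly_pCons_hom)
  ultimately have "of_nat p ^ (r + 1 - k) * l k x + y x ^ p ^ k * (of_nat p ^ (r - k) * z k x) = 0"
    using x unfolding is_root_def by (simp add: algebra_simps)
  then have "of_nat p ^ (r - k) * (y x ^ p ^ k * z k x + of_nat p * l k x) = 0"
    using k by (simp add: Suc_diff_le algebra_simps)
  then show ?thesis by (simp add: add_eq_0_iff)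
qed

text \<open>The polynomial does not depend on \<open>x\<close>, so relations satisfied by
  \<open>z k\<close> at one root pass to all conjugates.\<close>

lemma z_rat_poly: "\<exists>f. \<forall>x. z k x = poly (map_poly of_rat f) x"
proof -
  interpret of_rat_poly_hom: map_poly_comm_ring_hom "of_rat :: rat \<Rightarrow> complex" ..
  define f :: "rat poly" where
    "f = smult (1 / of_nat p ^ (r - k)) (\<Sum>j\<in>{p ^ k..p ^ r}. smult (of_int (C j)) ((monom 1 s + [:of_int b:]) ^ (j - p ^ k)))"
  have "poly (map_poly of_rat f) x = z k x" for x :: complex
    unfolding f_def z_def y_def
    by (simp add: of_rat_hom.map_poly_hom_smult of_rat_poly_hom.hom_sum of_rat_poly_hom.hom_power of_rat_poly_hom.hom_add
        poly_sum of_rat_divide of_rat_power poly_monom of_rat_hom.map_poly_pCons_hom)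
  then show ?thesis by metis
qed

text \<open>Multiplying the recursion of \<open>z\<close> by \<open>z k\<close> and applying \<open>z_l\<close> gives a monic quadratic
  equation of \<open>z k\<close> over \<open>\<int>[x, z (Suc k)]\<close>.\<close>

lemma z_integral:
  assumes x: "is_root x" "algebraic_int x" and k: "\<kappa> \<le> k" "k \<le> r"
  shows "algebraic_int (z k x)"
  unfolding algebraic_int_iff_valuation_rings
proof (intro allI impI)
  fix V :: "complex set" assume V: "valuation_ring V"
  then interpret valuation_ring V .
  have xV: "x \<in> V" using V x(2) by (rule valuation_ring_algebraic_int)
  have sub: "t \<in> V" if "t \<in> int_adjoin x" for t using int_adjoin_subset[OF subring xV] that by blast
  have yV: "y x \<in> V" using xV by (auto simp: y_def)
  show "z k x \<in> V" using k(2,1)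
  proof (induction k rule: inc_induct)
    case base
    then show ?case by (simp add: z_top)
  next
    case (step k)
    let ?e = "p ^ Suc k - p ^ k"
    \<comment> \<open>The exponent \<open>?e\<close> is at least \<open>p ^ k\<close>, so
      \<open>y x ^ p ^ k * z k x\<close> can be split off; by \<open>z_l\<close> it equals
      \<open>- p * l k x\<close>, which cancels the denominator \<open>p\<close>.\<close>
    have "p ^ Suc k \<ge> 2 * p ^ k" using p3 by simp
    then have e: "?e = p ^ k + (?e - p ^ k)" by linarith
    have "z k x * (z k x - A k x) = z k x * (y x ^ ?e / of_nat p * z (Suc k) x)"
      using z_step[OF step(2), of x] by simp
    also have "\<dots> = (y x ^ p ^ k * z k x) * y x ^ (?e - p ^ k) / of_nat p * z (Suc k) x"
      by (subst e) (simp add: power_add ac_simps)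
    also have "\<dots> = - (l k x * y x ^ (?e - p ^ k) * z (Suc k) x)"
      using step(2) by (subst z_l[OF x(1)]) auto
    finally have eq: "z k x * (z k x - A k x) = - (l k x * y x ^ (?e - p ^ k) * z (Suc k) x)" .
    have "l k x \<in> V" "A k x \<in> V" "z (Suc k) x \<in> V"
      using step l_mem[of k x] A_mem[of k x] sub by auto
    then show ?case
      using yV by (intro quadratic_root_mem[OF _ _ eq] V_closed)
  qed
qed

end

section \<open>Roots on a prescribed side and their residue fields\<close>

locale trinomial_valuation =
  residue_valuation V tp + trinomial "CARD('p)" s r \<kappa> a b
  for V :: "complex set" and tp :: "'p::prime_card itself" and s r \<kappa> a b
begin

text \<open>The valuation of \<open>y x\<close> is the negated slope of the side, except that it may be larger on a
  leftmost side of length one, whose starting point may lie arbitrarily high.\<close>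

definition on_side :: "nat \<Rightarrow> complex \<Rightarrow> bool" where
  "on_side k x \<longleftrightarrow> is_root x \<and> x \<in> V \<and> y x \<in> \<mm> \<and> y x ^ side_len CARD('p) \<kappa> k / of_nat CARD('p) \<in> V \<and>
     (0 < \<kappa> \<or> \<kappa> < k \<longrightarrow> y x ^ side_len CARD('p) \<kappa> k / of_nat CARD('p) \<notin> \<mm>)"

lemma of_nat_nonunit_iff: "of_nat k \<in> \<mm> \<longleftrightarrow> CARD('p) dvd k"
  using of_int_nonunit_iff[of "int k"] by simp

text \<open>A suitably scaled expansion of the trinomial at \<zeta> has coefficients in
  \<open>V\<close>, with a unit at the right end of side \<open>k\<close> and, in general, at its
  left end too. Its root \<open>t\<close> gives \<open>x = \<zeta> + \<tau> * t\<close>. As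
  \<open>x ^ s - \<zeta> ^ s\<close> is \<open>x - \<zeta>\<close> times a unit, \<open>y x\<close>
  has the valuation of \<open>\<tau> * t\<close>.\<close>

lemma root_on_side:
  assumes \<zeta>: "\<zeta> ^ s = - of_int b" "\<zeta> \<in> V" and k: "\<kappa> \<le> k" "k \<le> r"
    and c0_unit: "0 < \<kappa> \<Longrightarrow> ipoly c0 \<zeta> / of_nat CARD('p) ^ (r + 1 - \<kappa>) \<notin> \<mm>"
  obtains x where "on_side k x" "x - \<zeta> \<in> \<mm>"
proof -
  define e where "e = side_len CARD('p) \<kappa> k"
  define \<omega> where "\<omega> = r + 1 - \<kappa>"
  define n where "n = s * CARD('p) ^ r"
  define M where "M = (r - k) * e + CARD('p) ^ k"
  have e0: "0 < e" using side_len_bounds(1)[OF p3 k(1)] by (simp add: e_def)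
  \<comment> \<open>An \<open>e\<close>-th root of \<open>p\<close> has the slope of the side as its
    valuation, so heights become integral exponents of \<tau>.\<close>
  obtain \<tau> :: complex where \<tau>: "\<tau> ^ e = of_nat CARD('p)" using nth_root_exists[OF e0] by blast
  have \<tau>0: "\<tau> \<noteq> 0" using \<tau> e0 by (cases "\<tau> = 0") (auto simp: power_0_left)
  have \<tau>m: "\<tau> \<in> \<mm>" using p_nonunit nonunit_powerD[of \<tau> e] by (simp add: \<tau>)
  then have \<tau>V: "\<tau> \<in> V" by (rule nonunits_subset)
  have s0: "s \<noteq> 0" using s by (cases s) auto
  have \<zeta>u: "\<zeta> \<notin> \<mm>"
  proof
    assume "\<zeta> \<in> \<mm>"
    then have "of_int (- b) \<in> \<mm>" using nonunit_power[of \<zeta> s] \<zeta> s0 by simp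
    then show False using b unfolding of_int_nonunit_iff by simp
  qed
  have M\<omega>: "M \<le> e * \<omega>" using side_len_bounds(5)[OF p3 k(1) k(2)] by (simp add: M_def e_def \<omega>_def mult.commute)
  have pe: "of_nat CARD('p) ^ i = \<tau> ^ (e * i)" for i by (simp add: power_mult \<tau>)
  \<comment> \<open>The substitution \<open>X \<mapsto> \<zeta> + \<tau> X\<close> makes the side \<open>k\<close> horizontal, of height \<open>M\<close>.\<close>
  define P where "P = smult (1 / \<tau> ^ M) ((monom 1 n + monom (of_int a) 1 + [:of_int b:]) \<circ>\<^sub>p [:\<zeta>, \<tau>:])"
  have P0: "poly P t = 0 \<longleftrightarrow> is_root (\<zeta> + \<tau> * t)" for t
    using \<tau>0 by (simp add: P_def poly_pcompose poly_monom is_root_def n_def mult.commute)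
  define B where "B = (\<lambda>j. of_nat (n choose j) * \<tau> ^ j * \<zeta> ^ (n - j) / \<tau> ^ M)"
  have cP: "coeff P j = B j + (if j = 1 then of_int a * \<tau> / \<tau> ^ M else 0) +
      (if j = 0 then (of_int a * \<zeta> + of_int b) / \<tau> ^ M else 0)" for j
  proof -
    have "(monom 1 n + monom (of_int a) 1 + [:of_int b:]) \<circ>\<^sub>p [:\<zeta>, \<tau>:]
        = [:\<zeta>, \<tau>:] ^ n + [:of_int a * \<zeta> + of_int b, of_int a * \<tau>:]"
      by (simp add: pcompose_add pcompose_pCons pcompose_hom.hom_power
          monom_altdef[of 1 n] monom_Suc monom_0)
    moreover have "coeff ([:\<zeta>, \<tau>:] ^ n) j = of_nat (n choose j) * \<tau> ^ j * \<zeta> ^ (n - j)"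
    proof (cases "j \<le> n")
      case False
      moreover have "degree ([:\<zeta>, \<tau>:] ^ n) \<le> n"
        using degree_power_le[of "[:\<zeta>, \<tau>:]" n] \<tau>0 by simp
      ultimately show ?thesis by (simp add: coeff_eq_0)
    qed (rule coeff_linear_poly_power)
    ultimately show ?thesis
      by (auto simp: P_def B_def add_divide_distrib coeff_pCons split: nat.splits)
  qed
  have cP0: "coeff P 0 = ipoly c0 \<zeta> / \<tau> ^ M"
  proof -
    have "\<zeta> ^ n = (- of_int b) ^ CARD('p) ^ r" by (simp add: n_def power_mult \<zeta>)
    then show ?thesis
      by (simp add: cP B_def c0_def of_int_hom.map_poly_pCons_hom add_divide_distrib)
  qed
  obtain w where w: "w \<in> V" "ipoly c0 \<zeta> = of_nat CARD('p) ^ \<omega> * w"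
  proof -
    obtain a' b' where "a = int CARD('p) ^ \<omega> * a'" "(-b) ^ CARD('p) ^ r + b = int CARD('p) ^ \<omega> * b'"
      using a_dvd c0_dvd unfolding \<omega>_def by (auto elim!: dvdE)
    then have "ipoly c0 \<zeta> = of_nat CARD('p) ^ \<omega> * (of_int b' + of_int a' * \<zeta>)"
      unfolding c0_def by (simp add: of_int_hom.map_poly_pCons_hom algebra_simps)
    moreover have "of_int b' + of_int a' * \<zeta> \<in> V" using \<zeta>(2) by simp
    ultimately show ?thesis using that by metis
  qed
  have cP0': "coeff P 0 = w * \<tau> ^ (e * \<omega> - M)"
    using \<tau>0 M\<omega> by (simp add: cP0 w(2) pe power_diff)
  \<comment> \<open>The term \<open>a * x\<close> contributes to index 1 with one spare factor
    \<tau>, so it cannot affect whether a coefficient is a unit.\<close>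
  have am: "of_int a * \<tau> / \<tau> ^ M \<in> \<mm>"
  proof -
    obtain a' where a': "a = int CARD('p) ^ \<omega> * a'" using a_dvd unfolding \<omega>_def by auto
    have "of_int a * \<tau> / \<tau> ^ M = \<tau> * (\<tau> ^ (e * \<omega> - M) * of_int a')"
      using \<tau>0 M\<omega> by (simp add: a' pe power_diff)
    then show ?thesis using \<tau>m \<tau>V by (auto intro!: nonunit_mult(1))
  qed
  have Beq: "B j = of_nat t * \<zeta> ^ (n - j) * \<tau> ^ ((r - i) * e + j - M)"
    if "(n choose j) = CARD('p) ^ (r - i) * t" "M \<le> (r - i) * e + j" for i j t
    using that \<tau>0 by (simp add: B_def pe power_diff power_add mult.commute)
  have BV: "B j \<in> V" if j: "0 < j" for j
  proof -
    obtain i where i: "i \<le> r" "CARD('p) ^ i \<le> j" "CARD('p) ^ (r - i) dvd (n choose j)"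
      unfolding n_def using prime_power_dvd_binomial_exp[OF prime_p j] .
    then obtain t where "(n choose j) = CARD('p) ^ (r - i) * t" by blast
    moreover have "M \<le> (r - i) * e + j"
      using side_len_supporting_line[OF p3 k i(1)] i(2) by (simp add: M_def e_def)
    ultimately have "B j = of_nat t * \<zeta> ^ (n - j) * \<tau> ^ ((r - i) * e + j - M)" by (rule Beq)
    then show ?thesis using \<zeta> \<tau>V by simp
  qed
  have PV: "coeff P j \<in> V" for j
  proof (cases "j = 0")
    case True
    then show ?thesis using w \<tau>V by (simp add: cP0')
  next
    case False
    then show ?thesis using BV[of j] nonunits_subset[OF am] by (auto simp: cP)
  qed
  have vertex: "coeff P (CARD('p) ^ i) \<notin> \<mm>" if i: "i \<le> r" "(r - i) * e + CARD('p) ^ i = M" for i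
  proof -
    obtain t where t: "(n choose CARD('p) ^ i) = CARD('p) ^ (r - i) * t" "\<not> CARD('p) dvd t"
      using binomial_prime_power[OF prime_p s i(1)] unfolding n_def by metis
    have "B (CARD('p) ^ i) = of_nat t * \<zeta> ^ (n - CARD('p) ^ i)"
      using Beq[OF t(1)] i by simp
    then have "B (CARD('p) ^ i) \<notin> \<mm>"
      using t(2) \<zeta>u nonunit_prime[of "of_nat t" "\<zeta> ^ (n - CARD('p) ^ i)"] nonunit_powerD[of \<zeta>] of_nat_nonunit_iff[of t] by auto
    moreover have "coeff P (CARD('p) ^ i) - B (CARD('p) ^ i) \<in> \<mm>" using am by (simp add: cP)
    ultimately show ?thesis using unit_cong by blast
  qed
  have vk: "coeff P (CARD('p) ^ k) \<notin> \<mm>" using vertex[OF k(2)] by (simp add: M_def)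
  \<comment> \<open>Only for \<open>\<kappa> = k = 0\<close> may the left end of the side lie
    arbitrarily high; then the unit at index \<open>p ^ k\<close> still provides a root in
    \<open>V\<close>. In all other cases the left endpoint has a unit coefficient: at
    \<open>p ^ (k - 1)\<close>, or at 0 when \<open>k = \<kappa>\<close>.\<close>
  have "\<exists>t\<in>V. poly P t = 0 \<and> (0 < \<kappa> \<or> \<kappa> < k \<longrightarrow> t \<notin> \<mm>)"
  proof (cases "0 < \<kappa> \<or> \<kappa> < k")
    case True
    have "\<exists>i < CARD('p) ^ k. coeff P i \<notin> \<mm>"
    proof (cases "\<kappa> < k")
      case True
      then have e: "e = CARD('p) ^ k - CARD('p) ^ (k - 1)" by (simp add: e_def side_len_def)
      have "CARD('p) ^ (k - 1) < CARD('p) ^ k" using True by (intro p_power_less) simp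
      then have "e + CARD('p) ^ (k - 1) = CARD('p) ^ k" using e by simp
      moreover have "r - (k - 1) = Suc (r - k)" using True k by simp
      ultimately have "(r - (k - 1)) * e + CARD('p) ^ (k - 1) = M" by (simp add: M_def)
      then have "coeff P (CARD('p) ^ (k - 1)) \<notin> \<mm>" using k by (intro vertex) auto
      then show ?thesis using \<open>CARD('p) ^ (k - 1) < CARD('p) ^ k\<close> by auto
    next
      case False
      then have "k = \<kappa>" "0 < \<kappa>" using True k by auto
      then have "e * \<omega> = M" using k by (simp add: e_def M_def \<omega>_def side_len_def Suc_diff_le)
      then have "coeff P 0 = ipoly c0 \<zeta> / of_nat CARD('p) ^ \<omega>" by (simp add: cP0 pe)
      then show ?thesis using c0_unit \<open>0 < \<kappa>\<close> p_pos by (auto simp: \<omega>_def intro!: exI[of _ 0])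
    qed
    then obtain i where "i < CARD('p) ^ k" "coeff P i \<notin> \<mm>" by blast
    then show ?thesis
      using newton_polygon_root(2)[OF alg_closed_imp_poly_has_root PV vk, of i] by auto
  next
    case False
    then show ?thesis
      using newton_polygon_root(1)[OF alg_closed_imp_poly_has_root PV vk] by auto
  qed
  then obtain t where t: "t \<in> V" "poly P t = 0" "0 < \<kappa> \<or> \<kappa> < k \<Longrightarrow> t \<notin> \<mm>" by blast
  define x where "x = \<zeta> + \<tau> * t"
  have x: "is_root x" "x \<in> V" using t \<zeta> \<tau>V by (simp_all add: P0 x_def)
  have x\<zeta>: "x - \<zeta> \<in> \<mm>" using \<tau>m t by (simp add: x_def nonunit_mult)
  \<comment> \<open>The quotient of \<open>x ^ s - \<zeta> ^ s\<close> by
    \<open>x - \<zeta>\<close>; it is congruent to the derivative value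
    \<open>s * \<zeta> ^ (s - 1)\<close>, a unit.\<close>
  define W where "W = (\<Sum>i<s. x ^ i * \<zeta> ^ (s - 1 - i))"
  have "y x = x ^ s - \<zeta> ^ s" by (simp add: y_def \<zeta>)
  also have "\<dots> = (x - \<zeta>) * W"
    using diff_power_eq_sum[of x "s - 1" \<zeta>] s0 by (simp add: W_def)
  finally have yx: "y x = \<tau> * (t * W)" by (simp add: x_def)
  have WV: "W \<in> V" using x \<zeta> by (simp add: W_def)
  have "W - of_nat s * \<zeta> ^ (s - 1) = (\<Sum>i<s. (x ^ i - \<zeta> ^ i) * \<zeta> ^ (s - 1 - i))"
    by (simp add: W_def left_diff_distrib sum_subtractf flip: power_add)
  also have "\<dots> \<in> \<mm>"
    using ipoly_cong_arg[OF x\<zeta> x(2) \<zeta>(2), of "monom 1 i" for i] \<zeta>(2)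
    by (intro nonunit_sum nonunit_mult(1)) (auto simp: poly_monom)
  finally have "W - of_nat s * \<zeta> ^ (s - 1) \<in> \<mm>" .
  moreover have "of_nat s * \<zeta> ^ (s - 1) \<notin> \<mm>"
    using s \<zeta>u nonunit_prime nonunit_powerD of_nat_nonunit_iff by blast
  ultimately have Wu: "W \<notin> \<mm>" using unit_cong by blast
  have "y x ^ e / of_nat CARD('p) = (t * W) ^ e"
    using \<tau>0 unfolding yx power_mult_distrib[of \<tau>] \<tau>[symmetric] by simp
  moreover have "(t * W) ^ e \<in> V" using t WV by simp
  moreover have "(t * W) ^ e \<notin> \<mm>" if "0 < \<kappa> \<or> \<kappa> < k"
    using t(3)[OF that] Wu nonunit_prime nonunit_powerD by blast
  moreover have "y x \<in> \<mm>" unfolding yx using \<tau>m t WV by (intro nonunit_mult(1)) auto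
  ultimately have "on_side k x" using x by (simp add: on_side_def e_def)
  then show ?thesis using that x\<zeta> by blast
qed

text \<open>A double factor \<phi> of \<open>x ^ s + b\<close> would make the derivative vanish at
  the residue of \<open>x\<close>. Since \<open>p\<close> does not divide \<open>s\<close>, this
  residue would be zero, and \<open>b\<close> would be a nonunit.\<close>

lemma separable:
  assumes x: "x \<in> V" "y x \<in> \<mm>"
    and \<phi>: "Factorial_Ring.irreducible \<phi>" "\<phi> \<in> vanishing x" "red (monom 1 s + [:b:]) = \<phi> * Q"
  shows "Q \<notin> vanishing x"
proof
  assume "Q \<in> vanishing x"
  then have "\<phi> dvd Q" using vanishing_irreducible[OF x(1) \<phi>(1,2)] by auto
  then obtain R where R: "Q = \<phi> * R" ..
  have "pderiv (\<phi> * Q) = \<phi> * (\<phi> * pderiv R + 2 * R * pderiv \<phi>)"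
    by (simp add: R pderiv_mult algebra_simps)
  moreover have "pderiv (\<phi> * Q) = red (monom (int s) (s - 1))"
    by (simp add: \<phi>(3)[symmetric] of_int_poly_hom.hom_add pderiv_add pderiv_monom
        of_int_hom.map_poly_pCons_hom pderiv_pCons)
  ultimately have "red (monom (int s) (s - 1)) \<in> vanishing x"
    using vanishing_closed(2)[OF x(1) \<phi>(2)] by simp
  then have "of_nat s * x ^ (s - 1) \<in> \<mm>"
    using red_vanishing_iff[OF x(1), of "monom (int s) (s - 1)"] by (simp add: poly_monom)
  then have xm: "x \<in> \<mm>" using s nonunit_prime nonunit_powerD of_nat_nonunit_iff by blast
  have "s \<noteq> 0" using s by (cases s) auto
  then have "y x - x ^ s \<in> \<mm>" using x xm by (intro nonunit_diff nonunit_power) auto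
  then have "of_int b \<in> \<mm>" by (simp add: y_def)
  then show False using b unfolding of_int_nonunit_iff by simp
qed

text \<open>From vertex \<open>k\<close> on, descending from \<open>z r = 1\<close>, the later sides
  are longer than side \<open>k\<close>, so the recursion contributes a positive power of
  \<open>y x\<close> times \<open>Y\<close>. Before vertex \<open>k\<close>, \<open>z_l\<close> with
  \<open>p * Y = y x ^ e\<close> applies, where the length \<open>e\<close> exceeds
  \<open>p ^ j\<close>.\<close>

lemma on_side_z:
  fixes x :: complex and k :: nat
  defines "Y \<equiv> y x ^ side_len CARD('p) \<kappa> k / of_nat CARD('p)"
  defines "L \<equiv> local_closure V {x, Y}"
  assumes side: "on_side k x" and k: "\<kappa> \<le> k" "k \<le> r"
  shows "k \<le> j \<Longrightarrow> j \<le> r \<Longrightarrow> z j x - of_int (u j) \<in> (*) (y x) ` L"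
    and "\<kappa> \<le> j \<Longrightarrow> j < k \<Longrightarrow> \<exists>t\<in>int_adjoin x. z j x * Y = y x * t"
proof -
  let ?e = "side_len CARD('p) \<kappa> k"
  have sL: "subring_of L" unfolding L_def by (rule subring_of_local_closure)
  note Lc = subring_ofD[OF sL] subring_of_of_int[OF sL]
  have "x \<in> L" "Y \<in> L" unfolding L_def by (auto intro: local_closure.gen)
  then have aL: "int_adjoin x \<subseteq> L" using sL by (intro int_adjoin_subset)
  have yA: "y x \<in> int_adjoin x"
    using subring_ofD[OF subring_of_int_adjoin[of x]] int_adjoin_closed(1,2) by (simp add: y_def)
  have pY: "of_nat CARD('p) * Y = y x ^ ?e" by (simp add: Y_def)
  show "z j x - of_int (u j) \<in> (*) (y x) ` L" if "k \<le> j" "j \<le> r"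
    using that(2,1)
  proof (induction j rule: inc_induct)
    case base
    then show ?case using Lc(2) by (auto simp: z_top u_top intro: image_eqI[of _ _ 0])
  next
    case (step j)
    define d where "d = CARD('p) ^ Suc j - CARD('p) ^ j - ?e"
    have lt: "?e < CARD('p) ^ Suc j - CARD('p) ^ j"
      using step.prems by (intro side_len_bounds(3)[OF p3 k(1)])
    then obtain d' where d': "d = Suc d'" unfolding d_def by (metis Suc_diff_Suc)
    have "CARD('p) ^ Suc j - CARD('p) ^ j = ?e + d" using lt by (simp add: d_def)
    then have yY: "y x ^ (CARD('p) ^ Suc j - CARD('p) ^ j) / of_nat CARD('p) = Y * (y x * y x ^ d')"
      by (simp only: power_add Y_def d' power_Suc) simp
    obtain w where w: "w \<in> L" "z (Suc j) x - of_int (u (Suc j)) = y x * w" using step by auto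
    have "y x * w + of_int (u (Suc j)) \<in> L" using w yA aL by (intro Lc(4,6,8)) auto
    then have zL: "z (Suc j) x \<in> L" by (simp flip: w(2))
    obtain t where t: "t \<in> int_adjoin x" "A j x - of_int (u j) = y x * t" using A_cong by blast
    have "z j x - of_int (u j) = y x * t + Y * (y x * y x ^ d') * z (Suc j) x"
      using z_step[OF step(2), of x] t(2) unfolding yY by (simp add: algebra_simps)
    also have "\<dots> = y x * (t + Y * y x ^ d' * z (Suc j) x)" by (simp add: algebra_simps)
    finally show ?case
      using t aL zL yA \<open>Y \<in> L\<close> by (auto intro!: image_eqI Lc(4,6,7))
  qed
  show "\<exists>t\<in>int_adjoin x. z j x * Y = y x * t" if "\<kappa> \<le> j" "j < k"
  proof -
    have lt: "CARD('p) ^ j < ?e" using that by (intro side_len_bounds(4)[OF p3 k(1)])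
    then obtain d where d: "?e = CARD('p) ^ j + Suc d" by (metis less_imp_Suc_add add_Suc_right)
    have Yu: "Y \<notin> \<mm>" using side that unfolding on_side_def Y_def by auto
    have y0: "y x \<noteq> 0"
    proof
      assume "y x = 0"
      then have "Y = 0" by (simp add: Y_def d)
      then show False using Yu by simp
    qed
    have "y x ^ CARD('p) ^ j * (z j x * Y) = - ((of_nat CARD('p) * Y) * l j x)"
      using z_l[of x j] side that k by (simp add: on_side_def flip: mult.assoc)
    also have "\<dots> = y x ^ CARD('p) ^ j * (y x * (- (y x ^ d * l j x)))"
      unfolding pY d power_add power_Suc by (simp only: ac_simps mult_minus_right)
    finally have "z j x * Y = y x * (- (y x ^ d * l j x))"
      using y0 by (simp only: mult_cancel_left) simp
    moreover have "- (y x ^ d * l j x) \<in> int_adjoin x"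
      using l_mem[of j x] that k yA by (intro subring_ofD[OF subring_of_int_adjoin]) auto
    ultimately show ?thesis by blast
  qed
qed

text \<open>The side of a root can be read off from which quotients are nonunits; this is what
  separates primes belonging to the same \<phi>.\<close>

lemma z_nonunit_iff:
  assumes side: "on_side k x" and k: "\<kappa> \<le> k" "k \<le> r" and j: "\<kappa> \<le> j" "j \<le> r"
  shows "z j x \<in> \<mm> \<longleftrightarrow> j < k"
proof (cases "j < k")
  case True
  define Y where "Y = y x ^ side_len CARD('p) \<kappa> k / of_nat CARD('p)"
  obtain t where t: "t \<in> int_adjoin x" "z j x * Y = y x * t"
    using on_side_z(2)[OF side k j(1) True] unfolding Y_def by blast
  then have "z j x * Y \<in> \<mm>"
    using side int_adjoin_mem by (auto simp: on_side_def intro!: nonunit_mult(1))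
  moreover have "Y \<notin> \<mm>" using side j True by (auto simp: on_side_def Y_def)
  ultimately show ?thesis using nonunit_prime True by blast
next
  case False
  define L where "L = local_closure V {x, y x ^ side_len CARD('p) \<kappa> k / of_nat CARD('p)}"
  have "L \<subseteq> V" unfolding L_def using side by (intro local_closure_subset) (auto simp: on_side_def)
  then have "(*) (y x) ` L \<subseteq> \<mm>" using side by (auto simp: on_side_def intro!: nonunit_mult(1))
  moreover have "z j x - of_int (u j) \<in> (*) (y x) ` L"
    using on_side_z(1)[OF side k _ j(2)] False unfolding L_def by simp
  ultimately have "z j x - of_int (u j) \<in> \<mm>" by blast
  moreover have "of_int (u j) \<notin> \<mm>" using u_unit(1)[OF j(2)] of_int_nonunit_iff by simp
  ultimately show ?thesis using unit_cong False by blast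
qed

text \<open>Supplies the local data of \<open>residue_in_int_adjoin\<close>: a uniformizer, and a
  congruence that is linear in \<open>Y\<close> with unit coefficient \<open>u k\<close>. The latter
  keeps \<open>Y\<close> from enlarging the residue field.\<close>

lemma on_side_residue:
  assumes side: "on_side k x" and k: "\<kappa> \<le> k" "k \<le> r"
    and \<phi>: "Factorial_Ring.irreducible \<phi>" "\<phi> \<in> vanishing x" "\<phi> dvd red (monom 1 s + [:b:])"
    and \<rho>: "\<rho> \<in> V" "\<rho> = poly (map_poly of_rat f) x"
  obtains H where "\<rho> - ipoly H x \<in> \<mm>"
proof -
  let ?e = "side_len CARD('p) \<kappa> k"
  define Y where "Y = y x ^ ?e / of_nat CARD('p)"
  define L where "L = local_closure V {x, Y}"
  \<comment> \<open>On a leftmost side of length one \<open>y x\<close> may have a large valuation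
    or vanish, so \<open>p\<close> takes its place; otherwise \<open>Y\<close> is a unit and
    \<open>p\<close> is a power of \<open>y x\<close> up to a unit.\<close>
  define \<pi> where "\<pi> = (if 0 < \<kappa> \<or> \<kappa> < k then y x else of_nat CARD('p))"
  define D where "D = (*) \<pi> ` L"
  have xV: "x \<in> V" and yx: "y x \<in> \<mm>" and YV: "Y \<in> V"
    and Yu: "0 < \<kappa> \<or> \<kappa> < k \<Longrightarrow> Y \<notin> \<mm>" and root: "is_root x"
    using side by (auto simp: on_side_def Y_def)
  have sL: "subring_of L" unfolding L_def by (rule subring_of_local_closure)
  note Lc = subring_ofD[OF sL] subring_of_of_int[OF sL] subring_of_of_nat[OF sL]
  have thL: "x \<in> L" "Y \<in> L" unfolding L_def by (auto intro: local_closure.gen)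
  have Linv: "inverse t \<in> L" if "t \<in> L" "inverse t \<in> V" for t
    using that unfolding L_def by (rule local_closure.inv)
  have aL: "int_adjoin x \<subseteq> L" using sL thL by (intro int_adjoin_subset)
  then have iL: "ipoly U x \<in> L" for U by (auto simp: int_adjoin_def)
  have yL: "y x \<in> L" using thL Lc by (simp add: y_def)
  have LV: "L \<subseteq> V" unfolding L_def using xV YV by (intro local_closure_subset) auto
  have e0: "0 < ?e" using side_len_bounds(1)[OF p3 k(1)] .
  have pY: "of_nat CARD('p) * Y = y x ^ ?e" by (simp add: Y_def)
  have DI: "\<pi> * t \<in> D" if "t \<in> L" for t using that by (auto simp: D_def)
  have Dmult: "t * v \<in> D" "v * t \<in> D" if tv: "t \<in> D" "v \<in> L" for t v
  proof -
    obtain w where w: "t = \<pi> * w" "w \<in> L" using tv by (auto simp: D_def)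
    show "t * v \<in> D" using DI[of "w * v"] Lc(4) w tv by (simp add: mult.assoc)
    then show "v * t \<in> D" by (simp add: mult.commute)
  qed
  have Dadd: "t + v \<in> D" "t - v \<in> D" if tv: "t \<in> D" "v \<in> D" for t v
  proof -
    obtain w w' where "t = \<pi> * w" "w \<in> L" "v = \<pi> * w'" "w' \<in> L" using tv by (auto simp: D_def)
    then show "t + v \<in> D" "t - v \<in> D"
      using DI[of "w + w'"] DI[of "w - w'"] Lc(3,6) by (simp_all add: algebra_simps)
  qed
  obtain e' v where ev: "of_nat CARD('p) = \<pi> ^ e' * v" "0 < e'" "v \<in> L" "inverse v \<in> V"
  proof (cases "0 < \<kappa> \<or> \<kappa> < k")
    case True
    have "Y \<noteq> 0" using Yu[OF True] by auto
    then have "of_nat CARD('p) = \<pi> ^ ?e * inverse Y" using True by (simp add: \<pi>_def flip: pY)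
    moreover have "inverse Y \<in> L" using thL inverse_mem YV Yu[OF True] by (intro Linv) auto
    ultimately show ?thesis using that[of ?e "inverse Y"] e0 YV by simp
  next
    case False
    then show ?thesis using that[of 1 1] Lc(1) by (simp add: \<pi>_def)
  qed
  have \<pi>: "\<pi> \<in> L" "\<pi> \<in> \<mm>" using yL Lc yx p_nonunit by (auto simp: \<pi>_def)
  have pD: "of_nat CARD('p) \<in> D"
  proof -
    obtain e'' where "e' = Suc e''" using ev(2) by (cases e') auto
    then have "of_nat CARD('p) = \<pi> * (\<pi> ^ e'' * v)" using ev(1) by simp
    then show ?thesis using DI[OF Lc(4)[OF Lc(7)[OF \<pi>(1)] ev(3)], of e''] by metis
  qed
  have yD: "y x \<in> D"
  proof (cases "0 < \<kappa> \<or> \<kappa> < k")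
    case True
    then show ?thesis using DI[OF Lc(1)] by (simp add: \<pi>_def)
  next
    case False
    then have "?e = 1" using k by (simp add: side_len_def)
    then have "y x = of_nat CARD('p) * Y" by (simp add: pY)
    then show ?thesis using Dmult(1)[OF pD thL(2)] by simp
  qed
  have yDL: "(*) (y x) ` L \<subseteq> D" using Dmult(1)[OF yD] by auto
  \<comment> \<open>Up to a multiple of \<open>p\<close>, \<open>y x\<close> is \<phi>(x) times the
    cofactor at \<open>x\<close>, and the cofactor is a unit by separability.\<close>
  have \<phi>D: "ipoly (lift_poly \<phi>) x \<in> D"
  proof -
    obtain Q where Q: "red (monom 1 s + [:b:]) = \<phi> * Q" using \<phi>(3) ..
    define q where "q = ipoly (lift_poly Q) x"
    have "Q \<notin> vanishing x" by (rule separable[OF xV yx \<phi>(1,2) Q])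
    then have qu: "q \<notin> \<mm>" by (simp add: vanishing_def q_def)
    have qL: "q \<in> L" unfolding q_def by (rule iL)
    have "inverse q \<in> V" using qu qL LV by (intro inverse_mem) auto
    then have qi: "inverse q \<in> L" using qL by (intro Linv)
    have "red (monom 1 s + [:b:] - lift_poly \<phi> * lift_poly Q) = 0"
      unfolding of_int_poly_hom.hom_minus of_int_poly_hom.hom_mult of_int_poly_lift Q by simp
    then obtain W where W: "monom 1 s + [:b:] - lift_poly \<phi> * lift_poly Q = smult (int CARD('p)) W"
      by (rule of_int_poly_eq_0D)
    have "y x - ipoly (lift_poly \<phi>) x * q = ipoly (monom 1 s + [:b:] - lift_poly \<phi> * lift_poly Q) x"
      by (simp add: of_int_poly_hom.hom_minus of_int_poly_hom.hom_mult of_int_poly_hom.hom_add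
          of_int_hom.map_poly_pCons_hom poly_monom y_def q_def)
    also have "\<dots> = of_nat CARD('p) * ipoly W x" unfolding W by (simp add: of_int_hom.map_poly_hom_smult)
    finally have "ipoly (lift_poly \<phi>) x * q = y x - of_nat CARD('p) * ipoly W x" by (simp add: algebra_simps)
    also have "\<dots> \<in> D" by (rule Dadd(2)[OF yD Dmult(1)[OF pD iL]])
    finally have "ipoly (lift_poly \<phi>) x * q * inverse q \<in> D" using qi Dmult(1) by blast
    moreover have "q \<noteq> 0" using qu by auto
    ultimately show ?thesis by (simp only: mult.assoc right_inverse[OF \<open>q \<noteq> 0\<close>] mult_1_right)
  qed
  have zk: "z k x - of_int (u k) \<in> D"
    using on_side_z(1)[OF side k order.refl k(2)] yDL unfolding L_def Y_def by blast
  \<comment> \<open>Away from the leftmost side, \<open>z (k - 1)\<close> lies in \<open>D\<close>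
    and \<open>z_step\<close> gives the congruence; on the leftmost side \<open>z_l\<close> becomes
    \<open>Y * z k x = - l k x\<close>. In both cases \<open>z k x\<close> is replaced by
    \<open>u k\<close>.\<close>
  obtain w where w: "of_int (u k) * Y + w \<in> D" "w \<in> int_adjoin x"
  proof (cases "\<kappa> < k")
    case True
    then have e: "?e = CARD('p) ^ Suc (k - 1) - CARD('p) ^ (k - 1)" by (simp add: side_len_def)
    have "z (k - 1) x = A (k - 1) x + Y * z k x"
      using z_step[of "k - 1" x] True k unfolding e[symmetric] Y_def by simp
    then have "of_int (u k) * Y + A (k - 1) x = z (k - 1) x - Y * (z k x - of_int (u k))"
      by (simp add: algebra_simps)
    moreover have "z (k - 1) x \<in> D"
    proof -
      obtain t where t: "t \<in> int_adjoin x" "z (k - 1) x * Y = y x * t"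
        using on_side_z(2)[OF side k, of "k - 1"] True unfolding Y_def by fastforce
      have "inverse Y \<in> L" using thL inverse_mem YV Yu True by (intro Linv) auto
      then have "y x * t * inverse Y \<in> D" using t(1) aL by (intro Dmult(1)[OF Dmult(1)[OF yD]]) auto
      moreover have "Y \<noteq> 0" using Yu True by auto
      ultimately show ?thesis unfolding t(2)[symmetric]
        by (simp only: mult.assoc right_inverse[OF \<open>Y \<noteq> 0\<close>] mult_1_right)
    qed
    ultimately show ?thesis using that A_mem Dadd(2) Dmult(2)[OF zk thL(2)] by metis
  next
    case False
    then have e: "?e = CARD('p) ^ k" "k = \<kappa>" using k by (auto simp: side_len_def)
    have "of_nat CARD('p) * (Y * z k x) = of_nat CARD('p) * (- l k x)"
      using z_l[OF root k(2)] by (simp add: e(1)[symmetric] pY[symmetric] mult.assoc)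
    then have "Y * z k x = - l k x" by (simp only: mult_cancel_left) simp
    then have "of_int (u k) * Y + l k x = - (Y * (z k x - of_int (u k)))" by (simp add: algebra_simps)
    also have "\<dots> = (z k x - of_int (u k)) * (- Y)" by simp
    also have "\<dots> \<in> D" by (rule Dmult(1)[OF zk Lc(5)[OF thL(2)]])
    finally show ?thesis using that l_mem[OF k] by blast
  qed
  show ?thesis
    using residue_in_int_adjoin[of x Y \<pi> e' v "u k" w \<phi> \<rho> f] that
      xV YV \<pi> ev w u_unit(1)[OF k(2)] \<phi> \<phi>D \<rho>
    unfolding D_def L_def by metis
qed

end

section \<open>Number fields generated by a root\<close>

abbreviation rpoly :: "rat poly \<Rightarrow> complex \<Rightarrow> complex" where
  "rpoly f x \<equiv> poly (map_poly of_rat f) x"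

interpretation of_rat_poly: map_poly_comm_ring_hom "of_rat :: rat \<Rightarrow> complex" ..

lemma rpoly_pcompose: "rpoly (f \<circ>\<^sub>p g) x = rpoly f (rpoly g x)"
  by (simp add: of_rat_hom.map_poly_pcompose poly_pcompose)

lemma rpoly_of_int_poly: "rpoly (of_int_poly U) x = ipoly U x"
  by (simp add: map_poly_map_poly o_def)

lemma rpoly_root_imp_dvd:
  assumes "Factorial_Ring.irreducible F" "rpoly F x = 0" "rpoly f x = 0"
  shows "F dvd f"
proof (rule ccontr)
  assume "\<not> F dvd f"
  then have "coprime F f" using assms(1) by (intro prime_elem_imp_coprime irreducible_imp_prime_elem_gcd)
  then obtain A B where "A * F + B * f = 1" by (metis bezout_coefficients_fst_snd coprime_imp_gcd_eq_1)
  then have "rpoly (A * F + B * f) x = 1" by simp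
  then show False using assms by (simp add: of_rat_poly.hom_add of_rat_poly.hom_mult)
qed

lemma rat_adjoin_eq:
  assumes "Factorial_Ring.irreducible F" "rpoly F x = 0"
  shows "rat_adjoin x = range (\<lambda>f. rpoly f x)"
proof
  have "subfield_of_complex (range (\<lambda>f. rpoly f x))"
    unfolding subfield_of_complex_def
  proof (intro conjI ballI)
    show "1 \<in> range (\<lambda>f. rpoly f x)" by (rule range_eqI[of _ _ 1]) simp
    fix v assume "v \<in> range (\<lambda>f. rpoly f x)"
    then obtain f where f: "v = rpoly f x" by auto
    { fix w assume "w \<in> range (\<lambda>f. rpoly f x)"
      then obtain g where g: "w = rpoly g x" by auto
      show "v - w \<in> range (\<lambda>f. rpoly f x)"
        by (rule range_eqI[of _ _ "f - g"]) (simp add: f g of_rat_poly.hom_minus)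
      show "v * w \<in> range (\<lambda>f. rpoly f x)"
        by (rule range_eqI[of _ _ "f * g"]) (simp add: f g of_rat_poly.hom_mult) }
    show "inverse v \<in> range (\<lambda>f. rpoly f x)"
    proof (cases "v = 0")
      case True
      then show ?thesis by (intro range_eqI[of _ _ 0]) simp
    next
      case False
      then have "\<not> F dvd f" using assms(2) f by (auto simp: of_rat_poly.hom_mult elim!: dvdE)
      then have "coprime F f" using assms(1) by (intro prime_elem_imp_coprime irreducible_imp_prime_elem_gcd)
      then obtain A B where "A * F + B * f = 1" by (metis bezout_coefficients_fst_snd coprime_imp_gcd_eq_1)
      then have "rpoly (A * F + B * f) x = 1" by simp
      then have "rpoly B x * v = 1" using assms(2) by (simp add: f of_rat_poly.hom_add of_rat_poly.hom_mult)
      then have "inverse v = rpoly B x" by (metis inverse_unique mult.commute)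
      then show ?thesis by (rule range_eqI)
    qed
  qed
  moreover have "x \<in> range (\<lambda>f. rpoly f x)"
    by (rule range_eqI[of _ _ "[:0, 1:]"]) (simp add: of_rat_hom.map_poly_pCons_hom)
  ultimately show "rat_adjoin x \<subseteq> range (\<lambda>f. rpoly f x)" by (auto simp: rat_adjoin_def)
  show "range (\<lambda>f. rpoly f x) \<subseteq> rat_adjoin x"
    unfolding rat_adjoin_def
  proof (clarify)
    fix f L assume L: "subfield_of_complex L" "x \<in> L"
    then have sub: "subring_of L" and inv: "\<And>v. v \<in> L \<Longrightarrow> inverse v \<in> L"
      by (auto simp: subfield_of_complex_def subring_of_def)
    obtain d U where dU: "d \<noteq> 0" "of_int d * rpoly f x = ipoly U x" using clear_denominators .
    have "ipoly U x \<in> L" using int_adjoin_subset[OF sub L(2)] by (auto simp: int_adjoin_def)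
    then have "ipoly U x * inverse (of_int d) \<in> L"
      by (intro subring_ofD(4)[OF sub] inv subring_of_of_int[OF sub])
    moreover have "ipoly U x * inverse (of_int d) = rpoly f x"
      using dU(1) by (simp add: field_simps flip: dU(2))
    ultimately show "rpoly f x \<in> L" by simp
  qed
qed

section \<open>Counting the primes of a monogenic ring of integers\<close>

lemma lift_poly_monic:
  assumes "monic (f :: 'p::prime_card mod_ring poly)"
  shows "lead_coeff (lift_poly f) = 1" "degree (lift_poly f) = degree f"
proof -
  have z: "(to_int_mod_ring x :: int) = 0 \<longleftrightarrow> x = 0" for x :: "'p mod_ring"
    by (metis of_int_mod_ring_to_int_mod_ring of_int_mod_ring_hom.hom_zero to_int_mod_ring_hom.hom_zero)
  show d: "degree (lift_poly f) = degree f"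
    unfolding lift_poly_def by (rule degree_map_poly) (simp add: z)
  show "lead_coeff (lift_poly f) = 1"
    unfolding d using assms by (simp add: lift_poly_def coeff_map_poly z)
qed

lemma (in residue_valuation) finite_monic_irred:
  "finite {f :: 'p mod_ring poly. monic f \<and> Factorial_Ring.irreducible f \<and> degree f = m}"
  by (rule finite_subset[OF _ card_polys_degree_less(2)[of "Suc m"]]) (auto intro: coeff_eq_0)

section \<open>A root for every pair of a factor and a side\<close>

context trinomial_valuation
begin

text \<open>A root of a lift of \<phi> satisfies \<open>x ^ s + b = 0\<close> only modulo
  \<open>\<mm>\<close>. It is replaced by an exact root \<zeta> with the same residue, because the
  expansion at \<zeta> uses \<open>\<zeta> ^ s = - b\<close>. The last hypothesis puts the start of
  the polygon exactly at height \<open>r + 1 - \<kappa>\<close>.\<close>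

lemma exists_on_side:
  assumes \<phi>: "monic \<phi>" "Factorial_Ring.irreducible \<phi>" "\<phi> dvd red (monom 1 s + [:b:])"
    and k: "\<kappa> \<le> k" "k \<le> r"
    and c0_unit: "0 < \<kappa> \<Longrightarrow> \<not> \<phi> dvd red [:((-b) ^ CARD('p) ^ r + b) div int CARD('p) ^ (r + 1 - \<kappa>),
      a div int CARD('p) ^ (r + 1 - \<kappa>):]"
  obtains x where "on_side k x" "\<phi> \<in> vanishing x"
proof -
  have "\<not> is_unit \<phi>" using \<phi> by auto
  then have "degree \<phi> > 0" using \<phi>(1) by (metis monic_degree_0 neq0_conv dvd_refl)
  then have "degree (of_int_poly (lift_poly \<phi>) :: complex poly) > 0"
    using lift_poly_monic(2)[OF \<phi>(1)] by simp
  then obtain w where w: "ipoly (lift_poly \<phi>) w = 0" using alg_closed_imp_poly_has_root by blast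
  have "algebraic_int w"
    unfolding algebraic_int_altdef_ipoly using w lift_poly_monic(1)[OF \<phi>(1)] by blast
  then have wV: "w \<in> V" using valuation_ring_algebraic_int valuation_ring_axioms by blast
  have w\<phi>: "\<phi> \<in> vanishing w" using w by (simp add: vanishing_def)
  have s0: "0 < s" using s by (cases s) auto
  define P :: "complex poly" where "P = monom 1 s + [:of_int b:]"
  have Pr: "P = of_int_poly (monom 1 s + [:b:])"
    by (simp add: P_def of_int_poly_hom.hom_add of_int_hom.map_poly_pCons_hom)
  obtain Q where "red (monom 1 s + [:b:]) = \<phi> * Q" using \<phi>(3) ..
  then have "red (monom 1 s + [:b:]) \<in> vanishing w" using vanishing_closed(2)[OF wV w\<phi>] by simp
  then have Pw: "poly P w \<in> \<mm>" using wV unfolding Pr by (simp only: red_vanishing_iff)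
  have "degree P = s" unfolding P_def using s0 by (simp add: degree_add_eq_left degree_monom_eq)
  then have "lead_coeff P = 1" using s0 by (simp add: P_def coeff_pCons split: nat.splits)
  then obtain \<zeta> where \<zeta>: "poly P \<zeta> = 0" "w - \<zeta> \<in> \<mm>"
    using monic_value_nonunit[OF alg_closed_imp_poly_has_root _ Pw] by blast
  have \<zeta>b: "\<zeta> ^ s = - of_int b" using \<zeta>(1) by (simp add: P_def poly_monom add_eq_0_iff)
  have "w - (w - \<zeta>) \<in> V" using wV nonunits_subset[OF \<zeta>(2)] by (rule V_closed)
  then have \<zeta>V: "\<zeta> \<in> V" by simp
  have \<phi>\<zeta>: "\<phi> \<in> vanishing \<zeta>" using vanishing_cong_arg[OF \<zeta>(2) wV \<zeta>V] w\<phi> by simp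
  have "ipoly c0 \<zeta> / of_nat CARD('p) ^ (r + 1 - \<kappa>) \<notin> \<mm>" if "0 < \<kappa>"
  proof -
    let ?U = "[:((-b) ^ CARD('p) ^ r + b) div int CARD('p) ^ (r + 1 - \<kappa>), a div int CARD('p) ^ (r + 1 - \<kappa>):]"
    have "red ?U \<notin> vanishing \<zeta>"
      using c0_unit[OF that] vanishing_irreducible[OF \<zeta>V \<phi>(2) \<phi>\<zeta>] by simp
    then have "ipoly ?U \<zeta> \<notin> \<mm>" using red_vanishing_iff[OF \<zeta>V, of ?U] by blast
    moreover have "c0 = smult (int CARD('p) ^ (r + 1 - \<kappa>)) ?U" unfolding c0_def using c0_dvd a_dvd by simp
    then have "ipoly c0 \<zeta> = of_nat CARD('p) ^ (r + 1 - \<kappa>) * ipoly ?U \<zeta>"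
      by (simp only: of_int_hom.map_poly_hom_smult poly_smult of_int_power of_int_of_nat_eq)
    ultimately show ?thesis using p_pos by (metis nonzero_mult_div_cancel_left of_nat_eq_0_iff power_not_zero)
  qed
  then obtain x where x: "on_side k x" "x - \<zeta> \<in> \<mm>" using root_on_side[OF \<zeta>b \<zeta>V k] by blast
  have "vanishing x = vanishing \<zeta>" using x \<zeta>V by (intro vanishing_cong_arg) (auto simp: on_side_def)
  then show ?thesis using that x \<phi>\<zeta> by simp
qed

end

text \<open>To a pair (\<phi>, k) belongs the minimal polynomial over \<open>F_p\<close> of the
  residue of a conjugate of \<eta>. The proof shows that it has degree \<open>m\<close> and
  determines the pair.\<close>

lemma monogenic_imp_count_le:
  fixes tp :: "'p::prime_card itself" and F :: "rat poly"
  assumes r: "0 < r" and T: "trinomial CARD('p) s r \<kappa> a b"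
    and F: "F = of_int_poly (monom 1 (s * CARD('p) ^ r) + monom a 1 + [:b:])" "Factorial_Ring.irreducible F"
      "rpoly F \<theta> = 0"
    and mono: "monogenic (rat_adjoin \<theta>)"
    and c0_unit: "\<And>\<phi> :: 'p mod_ring poly. 0 < \<kappa> \<Longrightarrow> Factorial_Ring.irreducible \<phi> \<Longrightarrow> degree \<phi> = m \<Longrightarrow>
      \<phi> dvd monom 1 s + [:of_int b:] \<Longrightarrow>
      \<not> \<phi> dvd of_int_poly [:((-b) ^ CARD('p) ^ r + b) div int CARD('p) ^ (r + 1 - \<kappa>),
        a div int CARD('p) ^ (r + 1 - \<kappa>):]"
  shows "(r + 1 - \<kappa>) * num_monic_irred_factors tp m s b \<le> num_monic_irred tp m"
proof -
  interpret trinomial "CARD('p)" s r \<kappa> a b by fact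
  have ip: "inverse (of_nat CARD('p)) \<notin> (\<int> :: complex set)"
  proof
    assume "inverse (of_nat CARD('p)) \<in> (\<int> :: complex set)"
    then obtain k where "inverse (of_nat CARD('p)) = (of_int k :: complex)" by (auto elim: Ints_cases)
    then have "1 = (of_int (k * int CARD('p)) :: complex)" by (simp add: field_simps)
    then have "1 = k * int CARD('p)" by (metis of_int_1 of_int_eq_iff)
    then have "int CARD('p) dvd 1" by (metis dvd_triv_right)
    then show False using p3 by simp
  qed
  have "subring_of (\<int> :: complex set)" by (auto simp: subring_of_def)
  from exists_valuation_ring[OF this _ _ ip]
  obtain V :: "complex set" where V: "valuation_ring V" "of_nat CARD('p) \<in> nonunits V" by auto
  interpret trinomial_valuation V tp s r \<kappa> a b
    by (intro trinomial_valuation.intro residue_valuation.intro residue_valuation_axioms.intro V T)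
  have FR: "rpoly F x = 0 \<longleftrightarrow> is_root x" for x
    unfolding F(1) rpoly_of_int_poly
    by (simp add: is_root_def of_int_poly_hom.hom_add of_int_hom.map_poly_pCons_hom poly_monom)
  have transfer: "rpoly f x = 0" if "rpoly f \<theta> = 0" "is_root x" for f x
  proof -
    have "F dvd f" using F(2,3) that(1) by (rule rpoly_root_imp_dvd)
    then show ?thesis using that(2) by (auto elim!: dvdE simp: of_rat_poly.hom_mult FR)
  qed
  have transfer_eq: "rpoly f x = rpoly g x" if "rpoly f \<theta> = rpoly g \<theta>" "is_root x" for f g x
    using transfer[of "f - g" x] that by (simp add: of_rat_poly.hom_minus)
  define K where "K = rat_adjoin \<theta>"
  have KR: "K = range (\<lambda>f. rpoly f \<theta>)" unfolding K_def using F(2,3) by (rule rat_adjoin_eq)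
  obtain \<eta> where \<eta>: "\<eta> \<in> K" "algebraic_int \<eta>" "ring_of_integers K = int_adjoin \<eta>"
    using mono unfolding monogenic_def K_def[symmetric] ring_of_integers_def by auto
  obtain H where H: "\<eta> = rpoly H \<theta>" using \<eta>(1) KR by auto
  have mem: "\<exists>U. rpoly f \<theta> = ipoly U \<eta>" if "algebraic_int (rpoly f \<theta>)" for f
  proof -
    have "rpoly f \<theta> \<in> int_adjoin \<eta>" using that KR by (simp flip: \<eta>(3) add: ring_of_integers_def)
    then show ?thesis by (auto simp: int_adjoin_def)
  qed
  have \<theta>: "is_root \<theta>" using F(3) FR by simp
  have "algebraic_int \<theta>"
  proof -
    define n where "n = s * CARD('p) ^ r"
    have "0 < s" using s by (cases s) auto
    moreover have "CARD('p) ^ 1 \<le> CARD('p) ^ r" using r by (intro p_power_le) simp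
    ultimately have "CARD('p) * 1 \<le> CARD('p) ^ r * s" by (intro mult_le_mono) auto
    then have n: "1 < n" using p3 by (simp add: n_def mult.commute)
    define U where "U = monom 1 n + (monom a 1 + [:b:])"
    have "degree (monom a 1 + [:b:]) \<le> 1" by (intro degree_add_le) (auto intro: order.trans[OF degree_monom_le])
    then have "degree (monom a 1 + [:b:]) < degree (monom (1::int) n)" using n by (simp add: degree_monom_eq)
    then have "degree U = n" "lead_coeff U = 1"
      unfolding U_def using n by (simp_all add: degree_add_eq_left lead_coeff_add_le degree_monom_eq coeff_eq_0)
    moreover have "ipoly U \<theta> = 0"
      using F(3) unfolding F(1) rpoly_of_int_poly by (simp add: U_def n_def add.assoc)
    ultimately show ?thesis unfolding algebraic_int_altdef_ipoly by blast
  qed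
  moreover have X: "rpoly [:0, 1:] x = x" for x by (simp add: of_rat_hom.map_poly_pCons_hom)
  ultimately obtain T where T: "\<theta> = ipoly T \<eta>" using mem[of "[:0, 1:]"] by auto
  \<comment> \<open>At \<theta>, \<open>z j\<close> is an integer of the field, hence an integer
    polynomial in \<eta>. Conjugation keeps this polynomial the same for all roots.\<close>
  have "\<exists>U. \<forall>x. is_root x \<longrightarrow> z j x = ipoly U (rpoly H x)" if j: "\<kappa> \<le> j" "j \<le> r" for j
  proof -
    obtain f where f: "\<And>x. z j x = rpoly f x" using z_rat_poly by blast
    then obtain U where "rpoly f \<theta> = ipoly U \<eta>"
      using mem z_integral[OF \<theta> \<open>algebraic_int \<theta>\<close> j] by metis
    then have "rpoly f \<theta> = rpoly (of_int_poly U \<circ>\<^sub>p H) \<theta>"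
      by (simp only: rpoly_pcompose rpoly_of_int_poly H)
    then show ?thesis using transfer_eq[of f "of_int_poly U \<circ>\<^sub>p H"] f
      by (metis rpoly_pcompose rpoly_of_int_poly)
  qed
  then obtain Z where Z: "\<And>j x. \<kappa> \<le> j \<Longrightarrow> j \<le> r \<Longrightarrow> is_root x \<Longrightarrow> z j x = ipoly (Z j) (rpoly H x)"
    by metis
  have Tx: "x = ipoly T (rpoly H x)" if "is_root x" for x
  proof -
    have "rpoly [:0, 1:] \<theta> = rpoly (of_int_poly T \<circ>\<^sub>p H) \<theta>"
      using T H by (simp only: rpoly_pcompose rpoly_of_int_poly X)
    from transfer_eq[OF this that] show ?thesis by (simp only: rpoly_pcompose rpoly_of_int_poly X)
  qed
  have \<eta>V: "algebraic_int (rpoly H x)" if "is_root x" for x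
  proof -
    obtain P where P: "ipoly P \<eta> = 0" "lead_coeff P = 1"
      using \<eta>(2) by (auto simp: algebraic_int_altdef_ipoly)
    then have "rpoly (of_int_poly P \<circ>\<^sub>p H) \<theta> = 0" by (simp only: rpoly_pcompose rpoly_of_int_poly H)
    from transfer[OF this that] have "ipoly P (rpoly H x) = 0" by (simp only: rpoly_pcompose rpoly_of_int_poly)
    then show ?thesis using P(2) algebraic_int_altdef_ipoly by blast
  qed
  define \<Phi> :: "'p mod_ring poly set" where "\<Phi> = {f. monic f \<and> Factorial_Ring.irreducible f \<and> degree f = m \<and>
             f dvd monom 1 s + [:of_int b:]}"
  define G :: "'p mod_ring poly set" where "G = {f. monic f \<and> Factorial_Ring.irreducible f \<and> degree f = m}"
  define good where "good = (\<lambda>(\<phi>, k) g. g \<in> G \<and> (\<exists>x. on_side k x \<and> \<phi> \<in> vanishing x \<and>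
    vanishing (rpoly H x) = {h. g dvd h}))"
  have red_eq: "red (monom 1 s + [:b:]) = monom 1 s + [:of_int b:]"
    by (simp add: of_int_poly_hom.hom_add of_int_hom.map_poly_pCons_hom)
  have "\<exists>g. good (\<phi>, k) g" if \<phi>: "\<phi> \<in> \<Phi>" and k: "k \<in> {\<kappa>..r}" for \<phi> k
  proof -
    have \<phi>': "monic \<phi>" "Factorial_Ring.irreducible \<phi>" "\<phi> dvd red (monom 1 s + [:b:])" "degree \<phi> = m" "\<phi> \<noteq> 0"
      using \<phi> unfolding red_eq by (auto simp: \<Phi>_def)
    obtain x where x: "on_side k x" "\<phi> \<in> vanishing x"
      using exists_on_side[OF \<phi>'(1-3), of k] c0_unit \<phi>' k unfolding red_eq by auto
    then have xr: "is_root x" and xV: "x \<in> V" by (auto simp: on_side_def)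
    define \<rho> where "\<rho> = rpoly H x"
    have \<rho>a: "algebraic_int \<rho>" unfolding \<rho>_def using xr by (rule \<eta>V)
    then have \<rho>V: "\<rho> \<in> V" using V(1) valuation_ring_algebraic_int by blast
    obtain f where "f \<in> vanishing \<rho>" "f \<noteq> 0" using vanishing_algebraic_int[OF \<rho>a] .
    then obtain g where g: "monic g" "Factorial_Ring.irreducible g" "vanishing \<rho> = {h. g dvd h}"
      using vanishing_principal[OF \<rho>V] by metis
    have van: "vanishing x = {h. \<phi> dvd h}" using xV \<phi>'(2) x(2) by (rule vanishing_irreducible)
    obtain W where W: "\<rho> - ipoly W x \<in> \<mm>"
      using on_side_residue[OF x(1) _ _ \<phi>'(2) x(2) \<phi>'(3) \<rho>V \<rho>_def] k by auto
    have "g \<noteq> 0" using g by auto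
    \<comment> \<open>The residues of \<open>x\<close> and \<rho> are polynomials in each other: one
      direction by monogenicity, the other by \<open>on_side_residue\<close>. Hence the two degrees
      agree.\<close>
    have "x - ipoly T \<rho> \<in> \<mm>" using Tx[OF xr] by (simp add: \<rho>_def)
    then have "degree \<phi> \<le> degree g"
      using degree_vanishing_le[OF xV van \<phi>'(5) \<rho>V g(3) \<open>g \<noteq> 0\<close>] by blast
    moreover have "degree g \<le> degree \<phi>"
      using degree_vanishing_le[OF \<rho>V g(3) \<open>g \<noteq> 0\<close> xV van \<phi>'(5) W] .
    ultimately have "g \<in> G" using g \<phi>' by (simp add: G_def)
    then show ?thesis using x g(3) by (auto simp: good_def \<rho>_def)
  qed
  then have "\<forall>q\<in>\<Phi> \<times> {\<kappa>..r}. \<exists>g. good q g" by auto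
  then obtain \<Gamma> where \<Gamma>: "\<And>q. q \<in> \<Phi> \<times> {\<kappa>..r} \<Longrightarrow> good q (\<Gamma> q)" by metis
  \<comment> \<open>A common \<open>g\<close> means that the same integer polynomials vanish at both
    residues. Composing with \<open>T\<close> tests \<phi>, and \<open>Z k\<close> tests the side.
    The two halves are one-sided and are later applied with the pairs exchanged.\<close>
  have key: "\<phi>' dvd \<phi> \<and> k' \<le> k"
    if \<phi>: "\<phi>' \<in> \<Phi>" "k \<in> {\<kappa>..r}" "k' \<in> {\<kappa>..r}" and good: "good (\<phi>, k) g" "good (\<phi>', k') g"
    for \<phi> \<phi>' k k' g
  proof -
    obtain x x' where x: "on_side k x" "\<phi> \<in> vanishing x" "vanishing (rpoly H x) = {h. g dvd h}"
      and x': "on_side k' x'" "\<phi>' \<in> vanishing x'" "vanishing (rpoly H x') = {h. g dvd h}"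
      using good by (auto simp: good_def)
    have xr: "is_root x" "is_root x'" "x \<in> V" "x' \<in> V" using x x' by (auto simp: on_side_def)
    have \<rho>V: "rpoly H x \<in> V" "rpoly H x' \<in> V"
      using \<eta>V xr V(1) valuation_ring_algebraic_int by blast+
    have eq: "ipoly U (rpoly H x) \<in> \<mm> \<longleftrightarrow> ipoly U (rpoly H x') \<in> \<mm>" for U
      using red_vanishing_iff[OF \<rho>V(1), of U] red_vanishing_iff[OF \<rho>V(2), of U] x(3) x'(3) by simp
    have "ipoly (lift_poly \<phi> \<circ>\<^sub>p T) (rpoly H x) \<in> \<mm>"
      unfolding ipoly_pcompose Tx[OF xr(1), symmetric] using x(2) by (simp add: vanishing_def)
    then have "ipoly (lift_poly \<phi> \<circ>\<^sub>p T) (rpoly H x') \<in> \<mm>" by (simp add: eq)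
    then have "\<phi> \<in> vanishing x'"
      unfolding ipoly_pcompose Tx[OF xr(2), symmetric] by (simp add: vanishing_def)
    moreover have "vanishing x' = {h. \<phi>' dvd h}"
      using xr(4) _ x'(2) by (rule vanishing_irreducible) (use \<phi> in \<open>simp add: \<Phi>_def\<close>)
    ultimately have "\<phi>' dvd \<phi>" by simp
    moreover have "k' \<le> k"
    proof -
      have "z k x \<in> \<mm> \<longleftrightarrow> z k x' \<in> \<mm>" using Z[of k] \<phi> xr eq by simp
      then show ?thesis using z_nonunit_iff[OF x(1), of k] z_nonunit_iff[OF x'(1), of k] \<phi> by auto
    qed
    ultimately show ?thesis ..
  qed
  have "inj_on \<Gamma> (\<Phi> \<times> {\<kappa>..r})"
  proof (rule inj_onI)
    fix q q' assume q: "q \<in> \<Phi> \<times> {\<kappa>..r}" "q' \<in> \<Phi> \<times> {\<kappa>..r}" "\<Gamma> q = \<Gamma> q'"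
    obtain \<phi> k \<phi>' k' where qq: "q = (\<phi>, k)" "q' = (\<phi>', k')" by (metis surj_pair)
    have "good (\<phi>, k) (\<Gamma> q)" "good (\<phi>', k') (\<Gamma> q)" using \<Gamma>[OF q(1)] \<Gamma>[OF q(2)] q(3) qq by auto
    then have d: "\<phi>' dvd \<phi>" "\<phi> dvd \<phi>'" "k = k'"
      using key[of \<phi>' k k' \<phi> "\<Gamma> q"] key[of \<phi> k' k \<phi>' "\<Gamma> q"] q qq by auto
    have "monic \<phi>" "monic \<phi>'" using q qq by (auto simp: \<Phi>_def)
    then have "\<phi> = \<phi>'" using d by (metis poly_dvd_antisym)
    then show "q = q'" using d qq by simp
  qed
  moreover have "\<Gamma> ` (\<Phi> \<times> {\<kappa>..r}) \<subseteq> G" using \<Gamma> by (auto simp: good_def)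
  moreover have "finite G" unfolding G_def by (rule finite_monic_irred)
  ultimately have "card (\<Phi> \<times> {\<kappa>..r}) \<le> card G" by (rule card_inj_on_le)
  then show ?thesis
    by (simp add: card_cartesian_product num_monic_irred_factors_def num_monic_irred_def \<Phi>_def G_def mult.commute)
qed

section \<open>The numerical conditions and the contradiction\<close>

lemma num_monic_irred_1: "num_monic_irred TYPE('p::prime_card) 1 = CARD('p)"
proof -
  have "{f :: 'p mod_ring poly. monic f \<and> Factorial_Ring.irreducible f \<and> degree f = 1} = range (\<lambda>c. [:c, 1:])"
  proof (intro equalityI subsetI)
    fix f :: "'p mod_ring poly" assume "f \<in> {f. monic f \<and> Factorial_Ring.irreducible f \<and> degree f = 1}"
    then have f: "coeff f 1 = 1" "degree f = 1" by auto
    have "f = [:coeff f 0, 1:]"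
    proof (rule poly_eqI)
      fix i :: nat
      consider "i = 0" | "i = 1" | "1 < i" by linarith
      then show "coeff f i = coeff [:coeff f 0, 1:] i"
        using f by cases (auto simp: coeff_eq_0 coeff_pCons split: nat.splits)
    qed
    then show "f \<in> range (\<lambda>c. [:c, 1:])" by (rule range_eqI)
  qed (auto intro: irreducible_linear_field_poly)
  moreover have "inj (\<lambda>c :: 'p mod_ring. [:c, 1:])" by (auto intro: injI)
  ultimately show ?thesis by (simp add: num_monic_irred_def card_image)
qed

lemma padic_val_ge_iff:
  assumes "prime p"
  shows "enat k \<le> padic_val p t \<longleftrightarrow> int p ^ k dvd t"
proof -
  have "\<not> is_unit (int p)" using assms by (metis not_prime_unit prime_nat_int_transfer)
  then show ?thesis by (auto simp: padic_val_def power_dvd_iff_le_multiplicity)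
qed

lemma padic_val_not_dvd:
  assumes "prime p" "padic_val p t = enat k"
  shows "\<not> int p dvd t div int p ^ k"
proof -
  have "int p ^ k dvd t" using padic_val_ge_iff[OF assms(1), of k t] assms(2) by simp
  then obtain q where q: "t = int p ^ k * q" ..
  have "\<not> int p ^ Suc k dvd t"
    using padic_val_ge_iff[OF assms(1), of "Suc k" t] assms(2) by simp
  then have "\<not> int p dvd q" by (auto simp: q mult.commute)
  moreover have "t div int p ^ k = q" using assms(1) by (auto simp: q prime_gt_0_nat)
  ultimately show ?thesis by simp
qed

lemma ereal_div_less_imp_less:
  assumes "ereal (real x / real y) < ereal_of_enat \<omega>" "0 < y" "\<omega> = enat w"
  shows "x < w * y"
proof -
  have "real x / real y < real w" using assms by simp
  then have "real x < real (w * y)" using assms(2) by (simp add: divide_less_eq)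
  then show ?thesis by (simp only: of_nat_less_iff)
qed

lemma irreducible_dvd_linear:
  fixes \<phi> :: "'a::field poly"
  assumes "Factorial_Ring.irreducible \<phi>" "\<phi> dvd [:c, d:]" "c \<noteq> 0 \<or> d \<noteq> 0"
  shows "d \<noteq> 0" "degree \<phi> = 1"
proof -
  have nz: "[:c, d:] \<noteq> 0" using assms(3) by auto
  have "\<phi> \<noteq> 0" "\<not> is_unit \<phi>" using assms(1) by auto
  then have "degree \<phi> > 0" by (simp add: is_unit_iff_degree)
  moreover have "degree \<phi> \<le> degree [:c, d:]" using assms(2) nz by (rule dvd_imp_degree_le)
  ultimately show "d \<noteq> 0" "degree \<phi> = 1" by (auto split: if_splits)
qed

theorem theorem2p5:
  fixes n s r p :: nat
    and a b :: int
    and F :: "int poly"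
    and \<theta> :: complex
    and K :: "complex set"
    and \<mu> \<nu> \<delta> \<omega> :: enat
  assumes F: "F = Polynomial.monom 1 n + Polynomial.monom a 1 + [:b:]"
    and irred: "Factorial_Ring.irreducible (map_poly of_int F :: rat poly)"
    and root: "poly (map_poly of_int F) \<theta> = 0"
    and K: "K = rat_adjoin \<theta>"
    and p: "p = CARD('p::prime_card)" "prime p" "odd p"
    and p_dvd: "int p dvd a" "p dvd n" "\<not> int p dvd b"
    and n: "n = s * p ^ r" "\<not> p dvd s"
    and mu: "\<mu> = padic_val p a"
    and nu: "\<nu> = padic_val p (b ^ (p - 1) - 1)"
    and delta: "\<delta> = min \<mu> \<nu>"
    and omega: "\<omega> = min \<delta> (enat (r + 1))"
    and cond:
      "(\<delta> \<noteq> enat (r + 1) \<and>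
          (\<exists>m > 1. num_monic_irred_factors TYPE('p) m s b > 0 \<and>
             ereal_of_enat \<omega> >
               ereal (real (num_monic_irred TYPE('p) m) /
                      real (num_monic_irred_factors TYPE('p) m s b))))
       \<or> (num_monic_irred_factors TYPE('p) 1 s b > 0 \<and>
          ereal (real p / real (num_monic_irred_factors TYPE('p) 1 s b)) < ereal_of_enat \<mu> \<and>
          \<mu> < min \<nu> (enat (r + 1)))
       \<or> (num_monic_irred_factors TYPE('p) 1 s b > 0 \<and>
          ereal (real p / real (num_monic_irred_factors TYPE('p) 1 s b)) < ereal_of_enat \<nu> \<and>
          \<nu> < min \<mu> (enat (r + 1)))
       \<or> (num_monic_irred_factors TYPE('p) 1 s b > 0 \<and>
          real p / real (num_monic_irred_factors TYPE('p) 1 s b) < real (r + 1) \<and>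
          enat (r + 1) < \<delta>)"
  shows "\<not> monogenic K"
proof
  assume mono: "monogenic K"
  have "0 < r" using p_dvd(2) n by (cases r) auto
  obtain w where w: "\<omega> = enat w" by (metis omega enat_ord_code(3) infinity_ileE min.cobounded2 not_infinity_eq)
  have wr: "w \<le> r + 1" using omega w by (metis enat_ord_simps(1) min.cobounded2)
  have w\<mu>: "enat w \<le> \<mu>" and w\<nu>: "enat w \<le> \<nu>" unfolding w[symmetric] omega delta by (auto intro: min.coboundedI1)
  \<comment> \<open>All four conditions reduce to one strict inequality. For \<open>m = 1\<close> it
    is also recorded that the start of the polygon is harmless: either the two valuations differ, or
    \<open>w = r + 1\<close> and \<kappa> is zero.\<close>
  obtain m where m: "num_monic_irred TYPE('p) m < w * num_monic_irred_factors TYPE('p) m s b"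
    and m1: "m = 1 \<Longrightarrow> \<mu> \<noteq> \<nu> \<or> w = r + 1"
  proof -
    let ?N = "num_monic_irred_factors TYPE('p) 1 s b"
    consider (1) m where "m > 1" "num_monic_irred_factors TYPE('p) m s b > 0" "ereal_of_enat \<omega> >
               ereal (real (num_monic_irred TYPE('p) m) / real (num_monic_irred_factors TYPE('p) m s b))"
      | (2) "?N > 0" "ereal (real p / real ?N) < ereal_of_enat \<mu>" "\<mu> < \<nu>" "\<mu> < enat (r + 1)"
      | (3) "?N > 0" "ereal (real p / real ?N) < ereal_of_enat \<nu>" "\<nu> < \<mu>" "\<nu> < enat (r + 1)"
      | (4) "?N > 0" "real p / real ?N < real (r + 1)" "enat (r + 1) < \<delta>"
      using cond by auto
    then show thesis
    proof cases
      case 1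
      then show ?thesis using that[of m] ereal_div_less_imp_less[OF _ _ w] by auto
    next
      case 2
      then have "\<omega> = \<mu>" "\<mu> \<noteq> \<nu>" by (auto simp: omega delta)
      then show ?thesis using that[of 1] ereal_div_less_imp_less[OF _ _ w] 2 by (simp add: num_monic_irred_1[unfolded One_nat_def] p(1))
    next
      case 3
      then have "\<omega> = \<nu>" "\<mu> \<noteq> \<nu>" by (auto simp: omega delta)
      then show ?thesis using that[of 1] ereal_div_less_imp_less[OF _ _ w] 3 by (simp add: num_monic_irred_1[unfolded One_nat_def] p(1))
    next
      case 4
      then have "\<omega> = enat (r + 1)" by (simp add: omega)
      then show ?thesis using that[of 1] ereal_div_less_imp_less[OF _ _ w, of p ?N] 4 w
        by (simp add: num_monic_irred_1[unfolded One_nat_def] p(1))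
    qed
  qed
  then have w0: "0 < w" by (cases w) auto
  define \<kappa> where "\<kappa> = r + 1 - w"
  have \<kappa>: "\<kappa> \<le> r" "r + 1 - \<kappa> = w" using w0 wr by (auto simp: \<kappa>_def)
  obtain W where W: "b ^ p ^ r - b = b * (b ^ (p - 1) - 1) * W" "\<not> int p dvd W"
    using fermat_prime_power_diff[OF p(2) \<open>0 < r\<close> p_dvd(3)] .
  \<comment> \<open>Oddness turns \<open>(- b) ^ p ^ r + b\<close> into the negative of the
    difference from the Fermat lemma.\<close>
  have "odd (p ^ r)" using p(3) by simp
  then have c: "(- b) ^ p ^ r + b = - (b * (b ^ (p - 1) - 1) * W)" using W(1) by simp
  have a_dvd: "int p ^ w dvd a" using w\<mu> padic_val_ge_iff[OF p(2)] by (simp add: mu)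
  have \<nu>_dvd: "int p ^ w dvd b ^ (p - 1) - 1" using w\<nu> padic_val_ge_iff[OF p(2)] by (simp add: nu)
  then have c_dvd: "int p ^ w dvd (- b) ^ p ^ r + b" unfolding c by simp
  have T: "trinomial CARD('p) s r \<kappa> a b"
    using p p_dvd n \<kappa> a_dvd c_dvd by unfold_locales auto
  have pr: "prime (int p)" using p by simp
  have pw: "int p ^ w \<noteq> 0" using p by (auto simp: prime_gt_0_nat)
  \<comment> \<open>The reduction of \<open>c0\<close> divided by \<open>p ^ w\<close> is nonzero
    and of degree at most one, so an irreducible factor can divide it only for
    \<open>m = 1\<close>.\<close>
  have *: "\<not> \<phi> dvd of_int_poly [:((-b) ^ p ^ r + b) div int p ^ w, a div int p ^ w:]"
    if \<phi>: "0 < \<kappa>" "Factorial_Ring.irreducible \<phi>" "degree \<phi> = m" "\<phi> dvd monom 1 s + [:of_int b:]"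
    for \<phi> :: "'p mod_ring poly"
  proof
    let ?c = "((-b) ^ p ^ r + b) div int p ^ w" and ?a = "a div int p ^ w"
    assume d: "\<phi> dvd of_int_poly [:?c, ?a:]"
    have ww: "w < r + 1" using \<phi>(1) by (simp add: \<kappa>_def)
    have c_iff: "int p dvd ?c \<longleftrightarrow> int p dvd (b ^ (p - 1) - 1) div int p ^ w"
    proof -
      obtain q where q: "b ^ (p - 1) - 1 = int p ^ w * q" using \<nu>_dvd ..
      have "(- b) ^ p ^ r + b = int p ^ w * (- (b * q * W))" unfolding c q by (simp add: ac_simps)
      then have "?c = - (b * q * W)" using pw by (metis nonzero_mult_div_cancel_left)
      moreover have "(b ^ (p - 1) - 1) div int p ^ w = q" unfolding q using pw by simp
      ultimately show ?thesis using pr W(2) p_dvd(3) by (simp add: prime_dvd_mult_iff)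
    qed
    have a_unit: "\<not> int p dvd ?a" if "\<mu> = enat w" using padic_val_not_dvd[OF p(2)] that by (simp add: mu)
    have c_unit: "\<not> int p dvd ?c" if "\<nu> = enat w"
      unfolding c_iff using padic_val_not_dvd[OF p(2)] that by (simp add: nu)
    have "enat w = \<delta>" using w ww omega by (auto simp: min_def split: if_splits)
    then have or: "\<mu> = enat w \<or> \<nu> = enat w" by (auto simp: delta min_def split: if_splits)
    then have nz: "(of_int ?c :: 'p mod_ring) \<noteq> 0 \<or> (of_int ?a :: 'p mod_ring) \<noteq> 0"
      using a_unit c_unit by (auto simp: of_int_mod_ring_eq_0_iff p(1)[symmetric])
    have d': "\<phi> dvd [:of_int ?c, of_int ?a:]" using d by (simp add: of_int_hom.map_poly_pCons_hom)
    note lin = irreducible_dvd_linear[OF \<phi>(2) d' nz]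
    have "m = 1" using lin(2) \<phi>(3) by simp
    then have "\<mu> \<noteq> \<nu>" using m1 ww by auto
    \<comment> \<open>Divisibility by a linear \<phi> forces \<mu> = w, hence \<nu> > w, so the
      constant term vanishes modulo \<open>p\<close>. Then \<phi> divides the variable and, with
      \<open>x ^ s + b\<close>, also the nonzero constant \<open>b\<close>.\<close>
    have "\<not> int p dvd ?a" using lin(1) by (simp add: of_int_mod_ring_eq_0_iff p(1)[symmetric])
    then have "\<not> enat (Suc w) \<le> \<mu>"
      unfolding mu padic_val_ge_iff[OF p(2)] using a_dvd pw by (auto elim!: dvdE)
    then have "\<mu> = enat w" using w\<mu> by (metis Suc_ile_eq order_le_less)
    then have "enat (Suc w) \<le> \<nu>" using w\<nu> \<open>\<mu> \<noteq> \<nu>\<close> by (metis Suc_ile_eq order_le_less)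
    then have "int p ^ Suc w dvd b ^ (p - 1) - 1" using padic_val_ge_iff[OF p(2)] by (simp add: nu)
    then have "int p dvd (b ^ (p - 1) - 1) div int p ^ w" using pw by (auto elim!: dvdE)
    then have "(of_int ?c :: 'p mod_ring) = 0" using c_iff by (simp add: of_int_mod_ring_eq_0_iff p(1)[symmetric])
    then have "\<phi> dvd [:0, of_int ?a:]" using d' by simp
    also have "[:0, of_int ?a:] = smult (of_int ?a) [:0, 1:]" by simp
    finally have "\<phi> dvd [:0, 1:]" by (rule dvd_smult_cancel[OF _ lin(1)])
    moreover have "s \<noteq> 0" using n(2) by (cases s) auto
    then have "[:0, 1:] dvd (monom 1 s :: 'p mod_ring poly)" by (cases s) (auto simp: monom_Suc dvd_def intro!: exI[of _ "monom 1 (s - 1)"])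
    ultimately have "\<phi> dvd monom 1 s" using dvd_trans by blast
    then have "\<phi> dvd [:of_int b:]" using \<phi>(4) by (simp add: dvd_add_right_iff)
    moreover have "(of_int b :: 'p mod_ring) \<noteq> 0" using p_dvd(3) by (simp add: of_int_mod_ring_eq_0_iff p(1)[symmetric])
    ultimately have "degree \<phi> \<le> 0" using dvd_imp_degree_le[of \<phi> "[:of_int b:]"] by simp
    then show False using lin(2) by simp
  qed
  have "(r + 1 - \<kappa>) * num_monic_irred_factors TYPE('p) m s b \<le> num_monic_irred TYPE('p) m"
  proof (rule monogenic_imp_count_le[OF \<open>0 < r\<close> T _ irred])
    show "of_int_poly F = (of_int_poly (monom 1 (s * CARD('p) ^ r) + monom a 1 + [:b:]) :: rat poly)"
      by (simp add: F n p(1))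
    show "rpoly (of_int_poly F) \<theta> = 0" using root by (simp only: rpoly_of_int_poly)
    show "monogenic (rat_adjoin \<theta>)" using mono K by simp
  qed (unfold \<kappa>(2), rule *[unfolded p(1)])
  then show False using m \<kappa> by simp
qed

end
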